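(* Fix $p,q>1$ and let $g(t)=2^{1/4}e^{-\pi t^2}$. Given $\epsilon>0$, there exists a unit-norm exact system $\{f_n\}_{n=1}^{\infty}$ in $L^2(\mathbb{R})$ such that $$\forall n\in\mathbb{N},\quad |\mu_p(f_n)|<\epsilon,\quad |\mu_q(\widehat{f_n})|<\epsilon,\quad \Delta_p(f_n)<\Delta_p(g)+\epsilon,\quad \Delta_q(\widehat{f_n})<\Delta_q(\widehat{g})+\epsilon,$$ and such that the functions $\varphi(t)=\sup_{n\in\mathbb{N}}|f_n(t)|$ and $\psi(\xi)=\sup_{n\in\mathbb{N}}|\widehat{f_n}(\xi)|$ satisfy $\varphi,\psi\in L^2(\mathbb{R})$.
   Context: The Fourier transform on $L^2(\mathbb{R})$ is normalized by $\widehat{f}(\xi)=\int f(t)e^{-2\pi i t\xi}\,dt$. For $p>1$ and $h\in L^2(\mathbb{R})$ with $\|h\|_2=1$, the $p$-dispersion of $h$ is $\Delta_p(h)=\min_{a\in\mathbb{R}}\left(\int|t-a|^p|h(t)|^2\,dt\right)^{1/2}$ (equal to $\infty$ if $\int|t|^p|h(t)|^2\,dt=\infty$). When $\Delta_p(h)$ is finite, the $p$-mean $\mu_p(h)$ is the unique $a\in\mathbb{R}$ attaining this minimum (uniqueness holds by strict convexity since $p>1$). A bound on $\mu_p(h)$ or $\Delta_p(h)$ includes the requirement that the quantity be defined and finite. A system $\{f_n\}_{n=1}^\infty$ in a Hilbert space $H$ is minimal if for every $N\in\mathbb{N}$, $f_N\notin\overline{\mathrm{span}}\{f_n:n\neq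 N\}$. It is exact in $H$ if it is minimal and complete in $H$ (i.e. $\overline{\mathrm{span}}\{f_n\}_{n=1}^\infty=H$). Unit-norm means $\|f_n\|_2=1$ for all $n$. *)

theory Defs
  imports "HOL-Analysis.Analysis" "HOL-Library.Function_Algebras"
begin

(* Elements of L^2(R) are represented by Borel functions real => complex; every notion
   below is invariant under changing a function on a Lebesgue null set, apart from
   pointwise linear algebra, which is only used underneath an L^2 closure. Norms,
   dispersions and envelopes take values in ennreal, so that "infinite" is a genuine value
   and no bound can hold because an integral fails to exist. *)

definition ennreal_sqrt :: "ennreal \<Rightarrow> ennreal" where
  "ennreal_sqrt x = (if x = \<infinity> then \<infinity> else ennreal (sqrt (enn2real x)))"

definition L2_norm :: "(real \<Rightarrow> complex) \<Rightarrow> ennreal" where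
  "L2_norm h = ennreal_sqrt (\<integral>\<^sup>+ t. ennreal ((cmod (h t))\<^sup>2) \<partial>lborel)"

definition L2 :: "(real \<Rightarrow> complex) set" where
  "L2 = {h. h \<in> borel_measurable lborel \<and> L2_norm h < \<infinity>}"

(* Membership in L^2(R) for functions with values in [0, infinity], such as a supremum of
   countably many moduli. *)
definition nonneg_L2 :: "(real \<Rightarrow> ennreal) set" where
  "nonneg_L2 = {u. u \<in> borel_measurable lborel \<and> (\<integral>\<^sup>+ t. (u t)\<^sup>2 \<partial>lborel) < \<infinity>}"


(* For h in L^2(R) the integral defining the Fourier transform need not converge; it is the
   L^2 limit, as R tends to infinity, of the integrals over [-R, R], which exist because h is
   integrable on bounded sets. *)

definition truncated_fourier :: "real \<Rightarrow> (real \<Rightarrow> complex) \<Rightarrow> real \<Rightarrow> complex" where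
  "truncated_fourier R h \<xi> =
     (LINT t:{-R..R}|lborel. h t * exp (- 2 * of_real pi * \<i> * of_real t * of_real \<xi>))"

definition is_fourier_transform :: "(real \<Rightarrow> complex) \<Rightarrow> (real \<Rightarrow> complex) \<Rightarrow> bool" where
  "is_fourier_transform h F \<longleftrightarrow>
     F \<in> L2 \<and> ((\<lambda>R. L2_norm (F - truncated_fourier R h)) \<longlongrightarrow> 0) at_top"

(* An L^2 limit is unique up to a null set: this picks one representative. *)
definition fourier :: "(real \<Rightarrow> complex) \<Rightarrow> real \<Rightarrow> complex" where
  "fourier h = (SOME F. is_fourier_transform h F)"


definition centered_moment :: "real \<Rightarrow> (real \<Rightarrow> complex) \<Rightarrow> real \<Rightarrow> ennreal" where
  "centered_moment p h a = (\<integral>\<^sup>+ t. ennreal (\<bar>t - a\<bar> powr p * (cmod (h t))\<^sup>2) \<partial>lborel)"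

(* The infimum is attained for p > 1 and h in L^2(R), so it is a minimum. *)
definition dispersion :: "real \<Rightarrow> (real \<Rightarrow> complex) \<Rightarrow> ennreal" where
  "dispersion p h = (INF a. ennreal_sqrt (centered_moment p h a))"

(* Meaningful only when dispersion p h is finite. *)
definition p_mean :: "real \<Rightarrow> (real \<Rightarrow> complex) \<Rightarrow> real" where
  "p_mean p h =
     (THE a. is_arg_min (\<lambda>a. ennreal_sqrt (centered_moment p h a)) (\<lambda>_. True) a)"


definition fun_scale :: "complex \<Rightarrow> (real \<Rightarrow> complex) \<Rightarrow> real \<Rightarrow> complex" where
  "fun_scale c h = (\<lambda>t. c * h t)"

global_interpretation cfun: vector_space fun_scale
  by unfold_locales (auto simp: fun_scale_def fun_eq_iff algebra_simps)

definition L2_closed_span :: "(real \<Rightarrow> complex) set \<Rightarrow> (real \<Rightarrow> complex) set" where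
  "L2_closed_span S = {h \<in> L2. \<forall>\<delta>>0. \<exists>u \<in> cfun.span S. L2_norm (h - u) < \<delta>}"

definition minimal_system :: "(nat \<Rightarrow> real \<Rightarrow> complex) \<Rightarrow> bool" where
  "minimal_system f \<longleftrightarrow> (\<forall>N. f N \<notin> L2_closed_span (f ` {n. n \<noteq> N}))"

definition complete_system :: "(nat \<Rightarrow> real \<Rightarrow> complex) \<Rightarrow> bool" where
  "complete_system f \<longleftrightarrow> L2_closed_span (range f) = L2"

definition exact_system :: "(nat \<Rightarrow> real \<Rightarrow> complex) \<Rightarrow> bool" where
  "exact_system f \<longleftrightarrow> (\<forall>n. f n \<in> L2) \<and> minimal_system f \<and> complete_system f"


definition gaussian :: "real \<Rightarrow> complex" where
  "gaussian t = of_real (2 powr (1/4) * exp (- pi * t\<^sup>2))"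

end

theory Submission
  imports Defs "HOL-Probability.Probability" "HOL-Computational_Algebra.Polynomial"
begin

text \<open>
  Every member of the system is the Gaussian plus a tiny perturbation. Let \<open>h n\<close> be the
  \<open>n\<close>-th Hermite polynomial times the Gaussian \<open>g\<close>, so that \<open>h 0 = g\<close> and the \<open>h n\<close> are
  orthogonal, and put \<open>f n = c n * (g + e n * h (n + 1))\<close> with \<open>e n > 0\<close> rapidly decreasing and
  \<open>c n\<close> normalizing.

  Minimality comes from orthogonality: pairing with \<open>h (N + 1)\<close> annihilates \<open>g\<close> and every
  \<open>h (n + 1)\<close> with \<open>n \<noteq> N\<close>, hence every \<open>f n\<close> with \<open>n \<noteq> N\<close>, but not \<open>f N\<close>. Completeness comes
  from the smallness of the perturbation: \<open>f n / c n\<close> tends to \<open>g\<close>, so the closed span contains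
  \<open>g\<close>, then each \<open>h (n + 1)\<close>, then every polynomial times \<open>g\<close>; and these are dense
  (\<open>exact_perturbed_hermite_system\<close>, resting on \<open>V_eq_L2\<close>).

  Everything else is continuity in the size of the perturbation. The Fourier transform of a
  polynomial times \<open>g\<close> is again a polynomial times \<open>g\<close>, and \<open>g\<close> is its own transform, so \<open>f n\<close>
  and its transform have the same shape, with the same constants \<open>c n\<close> and \<open>e n\<close>
  (\<open>is_fourier_transform_perturbed_gaussian\<close>). For a perturbed Gaussian each centered
  moment tends to that of \<open>g\<close> as \<open>e\<close> tends to \<open>0\<close>. This bounds the dispersion directly. It also
  controls the mean: the moment is a strictly convex function of the center, so its minimizer
  lies in \<open>(- r, r)\<close> as soon as the moment at \<open>0\<close> is smaller than the moments at \<open>r\<close> and \<open>- r\<close>,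
  and for \<open>g\<close> these inequalities hold by symmetry (\<open>perturbed_gaussian_localized\<close>). Finally,
  both envelopes are square integrable because the norms of the perturbations \<open>e n * h (n + 1)\<close>
  and of their transforms are square summable (\<open>envelope_nonneg_L2\<close>).
\<close>

section \<open>Square integrable functions\<close>

text \<open>The square of the \<open>L2\<close> norm. In all closure arguments it only matters that it is small, so the
quasi-triangle inequality with constant \<open>2\<close> replaces Minkowski's inequality.\<close>

definition energy :: "(real \<Rightarrow> complex) \<Rightarrow> ennreal" where
  "energy h = (\<integral>\<^sup>+ t. ennreal ((cmod (h t))\<^sup>2) \<partial>lborel)"

lemma ennreal_sqrt_less_iff:
  assumes "0 < d"
  shows "ennreal_sqrt x < ennreal d \<longleftrightarrow> x < ennreal (d\<^sup>2)"
proof (cases x)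
  case (real r)
  have "sqrt r < d \<longleftrightarrow> r < d\<^sup>2"
    using assms real_sqrt_less_iff[of r "d\<^sup>2"] by (simp del: real_sqrt_less_iff)
  with real assms show ?thesis
    by (simp add: ennreal_sqrt_def ennreal_less_iff)
qed (simp add: ennreal_sqrt_def)

lemma ennreal_sqrt_ennreal: "0 \<le> r \<Longrightarrow> ennreal_sqrt (ennreal r) = ennreal (sqrt r)"
  by (simp add: ennreal_sqrt_def)

lemma ennreal_sqrt_less_top_iff: "ennreal_sqrt x < top \<longleftrightarrow> x < top"
  by (auto simp: ennreal_sqrt_def top.not_eq_extremum)

lemma ennreal_sqrt_le_iff: "ennreal_sqrt x \<le> ennreal_sqrt y \<longleftrightarrow> x \<le> y"
  by (cases x; cases y) (auto simp: ennreal_sqrt_def top_unique)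

lemma L2_norm_less_iff: "0 < d \<Longrightarrow> L2_norm h < ennreal d \<longleftrightarrow> energy h < ennreal (d\<^sup>2)"
  by (simp add: L2_norm_def energy_def ennreal_sqrt_less_iff)

lemma mem_L2_iff: "h \<in> L2 \<longleftrightarrow> h \<in> borel_measurable lborel \<and> energy h < \<infinity>"
  by (simp add: L2_def L2_norm_def energy_def ennreal_sqrt_less_top_iff)

lemma mem_L2_borel [measurable_dest]: "h \<in> L2 \<Longrightarrow> h \<in> borel_measurable borel"
  by (simp add: mem_L2_iff)

lemma cmod_add_sq_le: "(cmod (x + y))\<^sup>2 \<le> 2 * (cmod x)\<^sup>2 + 2 * (cmod y)\<^sup>2"
proof -
  have "(cmod (x + y))\<^sup>2 \<le> (cmod x + cmod y)\<^sup>2"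
    by (simp add: norm_triangle_ineq power_mono)
  also have "\<dots> \<le> 2 * (cmod x)\<^sup>2 + 2 * (cmod y)\<^sup>2"
    using sum_squares_bound[of "cmod x" "cmod y"] by (simp add: power2_sum)
  finally show ?thesis .
qed

lemma energy_add_le:
  assumes [measurable]: "u \<in> borel_measurable borel" "v \<in> borel_measurable borel"
  shows "energy (u + v) \<le> 2 * energy u + 2 * energy v"
proof -
  have "energy (u + v) \<le> (\<integral>\<^sup>+ t. 2 * ennreal ((cmod (u t))\<^sup>2) + 2 * ennreal ((cmod (v t))\<^sup>2) \<partial>lborel)"
    unfolding energy_def
  proof (intro nn_integral_mono)
    fix t
    have eq: "2 * ennreal ((cmod (u t))\<^sup>2) + 2 * ennreal ((cmod (v t))\<^sup>2)
        = ennreal (2 * (cmod (u t))\<^sup>2 + 2 * (cmod (v t))\<^sup>2)"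
      by (simp add: ennreal_plus ennreal_mult)
    then show "ennreal ((cmod ((u + v) t))\<^sup>2) \<le> 2 * ennreal ((cmod (u t))\<^sup>2) + 2 * ennreal ((cmod (v t))\<^sup>2)"
      unfolding eq using cmod_add_sq_le[of "u t" "v t"] by (intro ennreal_leI) simp
  qed
  also have "\<dots> = 2 * energy u + 2 * energy v"
    unfolding energy_def by (subst nn_integral_add) (auto simp: nn_integral_cmult)
  finally show ?thesis .
qed

lemma energy_diff_le:
  assumes [measurable]: "u \<in> borel_measurable borel" "v \<in> borel_measurable borel" "w \<in> borel_measurable borel"
  shows "energy (u - w) \<le> 2 * energy (u - v) + 2 * energy (v - w)"
proof -
  have "u - w = (u - v) + (v - w)" by (auto simp: fun_eq_iff)
  moreover have "u - v \<in> borel_measurable borel" "v - w \<in> borel_measurable borel"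
    by (simp_all add: fun_diff_def)
  ultimately show ?thesis using energy_add_le by metis
qed

lemma energy_scale: "energy (fun_scale c u) = ennreal ((cmod c)\<^sup>2) * energy u"
  if [measurable]: "u \<in> borel_measurable borel"
  unfolding energy_def fun_scale_def
  by (simp add: norm_mult power_mult_distrib ennreal_mult nn_integral_cmult)

lemma L2_add: "u \<in> L2 \<Longrightarrow> v \<in> L2 \<Longrightarrow> u + v \<in> L2"
  using energy_add_le[of u v]
  by (auto simp: mem_L2_iff plus_fun_def ennreal_mult_less_top intro: le_less_trans)

lemma L2_scale: "u \<in> L2 \<Longrightarrow> fun_scale c u \<in> L2"
  by (auto simp: mem_L2_iff energy_scale ennreal_mult_less_top) (auto simp: fun_scale_def)

lemma L2_zero: "0 \<in> L2"
  by (auto simp: mem_L2_iff energy_def zero_fun_def)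

lemma L2_diff: "u \<in> L2 \<Longrightarrow> v \<in> L2 \<Longrightarrow> u - v \<in> L2"
  using L2_add[OF _ L2_scale[of v "-1"], of u] 
  by (simp add: fun_scale_def plus_fun_def fun_diff_def)

lemma L2_dominated:
  assumes "v \<in> borel_measurable borel" "\<And>t. cmod (v t) \<le> cmod (u t)" "u \<in> L2"
  shows "v \<in> L2"
proof -
  have "energy v \<le> energy u"
    unfolding energy_def by (intro nn_integral_mono ennreal_leI power_mono assms) auto
  then show ?thesis using assms by (auto simp: mem_L2_iff intro: le_less_trans)
qed

lemma span_subset_L2: "S \<subseteq> L2 \<Longrightarrow> cfun.span S \<subseteq> L2"
  by (rule cfun.span_minimal) (auto simp: cfun.subspace_def L2_zero L2_add L2_scale)

lemma mem_closed_span_iff: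
  "h \<in> L2_closed_span S \<longleftrightarrow> h \<in> L2 \<and> (\<forall>d>0. \<exists>u\<in>cfun.span S. energy (h - u) < ennreal d)"
proof safe
  fix d :: real assume h: "h \<in> L2_closed_span S" and d: "d > 0"
  then have "ennreal (sqrt d) > 0" by simp
  with h obtain u where "u \<in> cfun.span S" "L2_norm (h - u) < ennreal (sqrt d)"
    unfolding L2_closed_span_def by blast
  then show "\<exists>u\<in>cfun.span S. energy (h - u) < ennreal d"
    using d by (auto simp: L2_norm_less_iff)
next
  assume h: "h \<in> L2" and *: "\<forall>d>0. \<exists>u\<in>cfun.span S. energy (h - u) < ennreal d"
  show "h \<in> L2_closed_span S"
    unfolding L2_closed_span_def
  proof (intro CollectI conjI h allI impI)
    fix \<delta> :: ennreal assume "\<delta> > 0"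
    then obtain r where r: "0 < ennreal r" "ennreal r < \<delta>"
      by (metis dense ennreal_cases ennreal_less_top less_top order_less_imp_not_less top.not_eq_extremum)
    then have "r > 0" by simp
    then obtain u where "u \<in> cfun.span S" "energy (h - u) < ennreal (r\<^sup>2)" using * by (meson zero_less_power)
    then show "\<exists>u\<in>cfun.span S. L2_norm (h - u) < \<delta>"
      using r \<open>r > 0\<close> by (intro bexI[of _ u]) (auto simp: L2_norm_less_iff[symmetric])
  qed
qed (auto simp: L2_closed_span_def)

lemma ennreal_quarters: "0 \<le> d \<Longrightarrow> 2 * ennreal (d/4) + 2 * ennreal (d/4) = ennreal d"
  using ennreal_mult[of 2 "d/4"] ennreal_plus[of "d/2" "d/2"] by simp

lemma span_subset_closed_span: "S \<subseteq> L2 \<Longrightarrow> cfun.span S \<subseteq> L2_closed_span S"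
proof
  fix u assume "S \<subseteq> L2" "u \<in> cfun.span S"
  moreover have "energy (u - u) = 0" by (simp add: energy_def)
  ultimately show "u \<in> L2_closed_span S"
    using span_subset_L2[of S] unfolding mem_closed_span_iff by (metis ennreal_less_zero_iff subsetD)
qed

lemma closed_span_subset_L2: "L2_closed_span S \<subseteq> L2"
  by (auto simp: L2_closed_span_def)

lemma closed_span_closed:
  assumes S: "S \<subseteq> L2" and h: "h \<in> L2"
    and approx: "\<And>d. d > 0 \<Longrightarrow> \<exists>v\<in>L2_closed_span S. energy (h - v) < ennreal d"
  shows "h \<in> L2_closed_span S"
  unfolding mem_closed_span_iff
proof (intro conjI h allI impI)
  fix d :: real assume "d > 0"
  then obtain v where v: "v \<in> L2_closed_span S" "energy (h - v) < ennreal (d/4)"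
    using approx[of "d/4"] by auto
  with \<open>d > 0\<close> obtain u where u: "u \<in> cfun.span S" "energy (v - u) < ennreal (d/4)"
    unfolding mem_closed_span_iff by (metis divide_pos_pos zero_less_numeral)
  have m: "u \<in> L2" "v \<in> L2"
    using u(1) v(1) span_subset_L2[OF S] closed_span_subset_L2 by blast+
  have "energy (h - u) \<le> 2 * energy (h - v) + 2 * energy (v - u)"
    using h m by (intro energy_diff_le mem_L2_borel)
  also have "\<dots> < 2 * ennreal (d/4) + 2 * ennreal (d/4)"
    using u v by (intro add_strict_mono ennreal_mult_strict_left_mono) auto
  also have "\<dots> = ennreal d"
      using \<open>d > 0\<close> by (intro ennreal_quarters) simp
  finally show "\<exists>u\<in>cfun.span S. energy (h - u) < ennreal d" using u by blast
qed

lemma closed_span_add: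
  assumes S: "S \<subseteq> L2" and h: "h \<in> L2_closed_span S" "k \<in> L2_closed_span S"
  shows "h + k \<in> L2_closed_span S"
proof -
  note L = subsetD[OF closed_span_subset_L2]
  show ?thesis unfolding mem_closed_span_iff
  proof (intro conjI L2_add L[OF h(1)] L[OF h(2)] allI impI)
    fix d :: real assume "d > 0"
    then have "d/4 > 0" by simp
    then obtain u v where uv: "u \<in> cfun.span S" "energy (h - u) < ennreal (d/4)"
        "v \<in> cfun.span S" "energy (k - v) < ennreal (d/4)"
      using h unfolding mem_closed_span_iff by meson
    have m: "u \<in> L2" "v \<in> L2" using uv S span_subset_L2 by auto
    have eq: "h + k - (u + v) = (h - u) + (k - v)" by (auto simp: fun_eq_iff)
    have "energy (h + k - (u + v)) \<le> 2 * energy (h - u) + 2 * energy (k - v)"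
      unfolding eq using m L[OF h(1)] L[OF h(2)] by (intro energy_add_le mem_L2_borel L2_diff)
    also have "\<dots> < 2 * ennreal (d/4) + 2 * ennreal (d/4)"
      using uv by (intro add_strict_mono ennreal_mult_strict_left_mono) auto
    also have "\<dots> = ennreal d"
      using \<open>d > 0\<close> by (intro ennreal_quarters) simp
    finally show "\<exists>u\<in>cfun.span S. energy (h + k - u) < ennreal d"
      using uv cfun.span_add by blast
  qed
qed

lemma closed_span_scale:
  assumes S: "S \<subseteq> L2" and h: "h \<in> L2_closed_span S"
  shows "fun_scale c h \<in> L2_closed_span S"
proof -
  note L = subsetD[OF closed_span_subset_L2]
  show ?thesis unfolding mem_closed_span_iff
  proof (intro conjI L2_scale L[OF h] allI impI)
    fix d :: real assume d: "d > 0"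
    define b where "b = (cmod c)\<^sup>2 + 1"
    have b: "b > 0" "(cmod c)\<^sup>2 \<le> b" unfolding b_def by (auto intro: add_nonneg_pos)
    obtain u where u: "u \<in> cfun.span S" "energy (h - u) < ennreal (d/b)"
      using h d b unfolding mem_closed_span_iff by (meson divide_pos_pos)
    have m: "h - u \<in> L2" using u S span_subset_L2 L[OF h] by (intro L2_diff) auto
    have eq: "fun_scale c h - fun_scale c u = fun_scale c (h - u)"
      by (auto simp: fun_eq_iff fun_scale_def algebra_simps)
    have "energy (fun_scale c h - fun_scale c u) \<le> ennreal b * energy (h - u)"
      unfolding eq energy_scale[OF mem_L2_borel[OF m]] using b by (intro mult_right_mono ennreal_leI) auto
    also have "\<dots> < ennreal b * ennreal (d/b)"
      using u b by (intro ennreal_mult_strict_left_mono) auto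
    also have "\<dots> = ennreal d" using b d by (simp add: ennreal_mult[symmetric])
    finally show "\<exists>u\<in>cfun.span S. energy (fun_scale c h - u) < ennreal d"
      using u cfun.span_scale by blast
  qed
qed

lemma closed_span_zero: "S \<subseteq> L2 \<Longrightarrow> 0 \<in> L2_closed_span S"
  using span_subset_closed_span cfun.span_zero by blast

lemma closed_span_diff:
  assumes "S \<subseteq> L2" "h \<in> L2_closed_span S" "k \<in> L2_closed_span S"
  shows "h - k \<in> L2_closed_span S"
  using closed_span_add[OF assms(1,2) closed_span_scale[OF assms(1,3), of "-1"]]
  by (simp add: fun_scale_def plus_fun_def fun_diff_def)

text \<open>Pointwise limits with a square integrable majorant stay in a closed span, because the energy of
the difference tends to \<open>0\<close> by dominated convergence. All limits in the completeness proof are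
taken through this lemma.\<close>

lemma closed_span_dominated_limit:
  assumes S: "S \<subseteq> L2" and v: "\<And>n. v n \<in> L2_closed_span S"
    and lim: "\<And>t. (\<lambda>n. v n t) \<longlonglongrightarrow> h t"
    and bound: "\<And>n t. cmod (v n t) \<le> cmod (w t)" and w: "w \<in> L2"
  shows "h \<in> L2_closed_span S"
proof -
  note L = subsetD[OF closed_span_subset_L2]
  have [measurable]: "v n \<in> borel_measurable borel" "w \<in> borel_measurable borel" for n
    using L[OF v] w by (auto intro: mem_L2_borel)
  have [measurable]: "h \<in> borel_measurable borel"
    by (rule borel_measurable_LIMSEQ_metric[OF _ lim]) auto
  have hb: "cmod (h t) \<le> cmod (w t)" for t
    by (rule Lim_bounded[OF tendsto_norm[OF lim], of 0]) (use bound in auto)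
  have hL2: "h \<in> L2" by (rule L2_dominated[OF _ hb w]) auto
  have "(\<lambda>n. energy (h - v n)) \<longlonglongrightarrow> (\<integral>\<^sup>+ t. 0 \<partial>(lborel :: real measure))"
    unfolding energy_def
  proof (rule nn_integral_dominated_convergence[where w = "\<lambda>t. ennreal (4 * (cmod (w t))\<^sup>2)"])
    show "AE t in lborel. ennreal ((cmod ((h - v n) t))\<^sup>2) \<le> ennreal (4 * (cmod (w t))\<^sup>2)" for n
    proof (intro AE_I2 ennreal_leI)
      fix t
      have "cmod (h t - v n t) \<le> 2 * cmod (w t)"
        using norm_triangle_ineq4[of "h t" "v n t"] hb[of t] bound[of n t] by simp
      then show "(cmod ((h - v n) t))\<^sup>2 \<le> 4 * (cmod (w t))\<^sup>2"
        using power_mono[of "cmod (h t - v n t)" "2 * cmod (w t)" 2] by (simp add: power_mult_distrib)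
    qed
    show "(\<integral>\<^sup>+ t. ennreal (4 * (cmod (w t))\<^sup>2) \<partial>lborel) < \<infinity>"
      using w by (simp add: ennreal_mult nn_integral_cmult mem_L2_iff energy_def ennreal_mult_less_top)
    show "AE t in lborel. (\<lambda>n. ennreal ((cmod ((h - v n) t))\<^sup>2)) \<longlonglongrightarrow> 0"
    proof (intro AE_I2)
      fix t
      have "(\<lambda>n. ennreal ((cmod (h t - v n t))\<^sup>2)) \<longlonglongrightarrow> ennreal ((cmod (h t - h t))\<^sup>2)"
        by (intro tendsto_ennrealI tendsto_intros lim)
      then show "(\<lambda>n. ennreal ((cmod ((h - v n) t))\<^sup>2)) \<longlonglongrightarrow> 0" by simp
    qed
  qed (simp_all add: fun_diff_def)
  then have lim0: "(\<lambda>n. energy (h - v n)) \<longlonglongrightarrow> 0" by simp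
  show ?thesis
  proof (rule closed_span_closed[OF S hL2])
    fix d :: real assume "d > 0"
    then have "\<forall>\<^sub>F n in sequentially. energy (h - v n) < ennreal d"
      by (intro order_tendstoD(2)[OF lim0]) simp
    then obtain n where "energy (h - v n) < ennreal d"
      by (auto simp: eventually_sequentially)
    then show "\<exists>v\<in>L2_closed_span S. energy (h - v) < ennreal d" using v by blast
  qed
qed

section \<open>Functions of exponential growth against Gaussian weights\<close>

text \<open>A class of functions closed under sums and products that contains the polynomials and the power
weights of the moments, and whose members all become integrable against a Gaussian. It replaces
separate integrability arguments for each moment.\<close>

definition exp_growth :: "(real \<Rightarrow> 'a::real_normed_vector) \<Rightarrow> bool" where
  "exp_growth \<phi> \<longleftrightarrow> \<phi> \<in> borel_measurable borel \<and> (\<exists>C c. \<forall>t. norm (\<phi> t) \<le> C * exp (c * \<bar>t\<bar>))"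

lemma exp_growth_borel [measurable_dest]: "exp_growth \<phi> \<Longrightarrow> \<phi> \<in> borel_measurable borel"
  by (simp add: exp_growth_def)

lemma exp_growthI:
  "\<phi> \<in> borel_measurable borel \<Longrightarrow> (\<And>t. norm (\<phi> t) \<le> C * exp (c * \<bar>t\<bar>)) \<Longrightarrow> exp_growth \<phi>"
  by (auto simp: exp_growth_def)

lemma exp_growthE:
  assumes "exp_growth \<phi>"
  obtains C c where "C \<ge> 0" "c \<ge> 0" "\<And>t. norm (\<phi> t) \<le> C * exp (c * \<bar>t\<bar>)"
proof -
  from assms obtain C c where *: "\<And>t. norm (\<phi> t) \<le> C * exp (c * \<bar>t\<bar>)"
    by (auto simp: exp_growth_def)
  have C: "C \<ge> 0" using order_trans[OF norm_ge_zero *[of 0]] by simp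
  have "norm (\<phi> t) \<le> C * exp (max c 0 * \<bar>t\<bar>)" for t
    by (rule order_trans[OF *]) (use C in \<open>auto intro!: mult_left_mono mult_right_mono\<close>)
  with C show ?thesis by (intro that[of C "max c 0"]) auto
qed

lemma exp_growth_mono:
  assumes "exp_growth \<psi>" "\<phi> \<in> borel_measurable borel" "\<And>t. norm (\<phi> t) \<le> norm (\<psi> t)"
  shows "exp_growth \<phi>"
  using assms unfolding exp_growth_def by (meson order_trans)

lemma exp_growth_exp: "exp_growth (\<lambda>t. exp (c * \<bar>t\<bar>) :: real)"
  by (rule exp_growthI[of _ 1 c]) auto

lemma exp_growth_bounded:
  "\<phi> \<in> borel_measurable borel \<Longrightarrow> (\<And>t. norm (\<phi> t) \<le> C) \<Longrightarrow> exp_growth \<phi>"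
  by (rule exp_growthI[of _ C 0]) auto

lemma exp_growth_const: "exp_growth (\<lambda>_. c)"
  by (rule exp_growth_bounded) auto

lemma exp_growth_add:
  fixes \<phi> \<psi> :: "real \<Rightarrow> 'a::{real_normed_vector, second_countable_topology}"
  assumes [measurable]: "exp_growth \<phi>" "exp_growth \<psi>"
  shows "exp_growth (\<lambda>t. \<phi> t + \<psi> t)"
proof -
  obtain C c where 1: "C \<ge> 0" "c \<ge> 0" "\<And>t. norm (\<phi> t) \<le> C * exp (c * \<bar>t\<bar>)"
    using exp_growthE[OF assms(1)] by blast
  obtain D d where 2: "D \<ge> 0" "d \<ge> 0" "\<And>t. norm (\<psi> t) \<le> D * exp (d * \<bar>t\<bar>)"
    using exp_growthE[OF assms(2)] by blast
  show ?thesis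
  proof (rule exp_growthI[of _ "C + D" "max c d"])
    fix t :: real
    have "norm (\<phi> t + \<psi> t) \<le> C * exp (c * \<bar>t\<bar>) + D * exp (d * \<bar>t\<bar>)"
      using 1 2 by (intro norm_triangle_mono)
    also have "\<dots> \<le> C * exp (max c d * \<bar>t\<bar>) + D * exp (max c d * \<bar>t\<bar>)"
      using 1 2 by (intro add_mono mult_left_mono) (auto intro!: mult_right_mono)
    finally show "norm (\<phi> t + \<psi> t) \<le> (C + D) * exp (max c d * \<bar>t\<bar>)" by (simp add: algebra_simps)
  qed auto
qed

lemma exp_growth_mult:
  fixes \<phi> \<psi> :: "real \<Rightarrow> 'a::{real_normed_algebra, second_countable_topology}"
  assumes [measurable]: "exp_growth \<phi>" "exp_growth \<psi>"
  shows "exp_growth (\<lambda>t. \<phi> t * \<psi> t)"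
proof -
  obtain C c where 1: "C \<ge> 0" "c \<ge> 0" "\<And>t. norm (\<phi> t) \<le> C * exp (c * \<bar>t\<bar>)"
    using exp_growthE[OF assms(1)] by blast
  obtain D d where 2: "D \<ge> 0" "d \<ge> 0" "\<And>t. norm (\<psi> t) \<le> D * exp (d * \<bar>t\<bar>)"
    using exp_growthE[OF assms(2)] by blast
  show ?thesis
  proof (rule exp_growthI[of _ "C * D" "c + d"])
    fix t :: real
    have "norm (\<phi> t * \<psi> t) \<le> (C * exp (c * \<bar>t\<bar>)) * (D * exp (d * \<bar>t\<bar>))"
      using 1 2 by (intro order_trans[OF norm_mult_ineq] mult_mono) auto
    then show "norm (\<phi> t * \<psi> t) \<le> C * D * exp ((c + d) * \<bar>t\<bar>)"
      by (simp add: algebra_simps exp_add)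
  qed auto
qed

lemma exp_growth_norm: "exp_growth \<phi> \<Longrightarrow> exp_growth (\<lambda>t. norm (\<phi> t))"
  by (rule exp_growth_mono[of \<phi>]) auto

lemma exp_growth_norm_sq: "exp_growth \<phi> \<Longrightarrow> exp_growth (\<lambda>t. (norm (\<phi> t))\<^sup>2)"
  unfolding power2_eq_square by (intro exp_growth_mult exp_growth_norm)

lemma exp_growth_of_real: "exp_growth (\<lambda>t. complex_of_real t)"
proof (rule exp_growthI[of _ 1 1])
  show "cmod (complex_of_real t) \<le> 1 * exp (1 * \<bar>t\<bar>)" for t
    using exp_ge_add_one_self[of "\<bar>t\<bar>"] unfolding norm_of_real mult_1 by linarith
qed auto

lemma exp_growth_poly: "exp_growth (\<lambda>t. poly P (complex_of_real t))"
  by (induction P) (auto intro!: exp_growth_add exp_growth_mult exp_growth_const exp_growth_of_real)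

lemma powr_le_exp: "\<exists>C\<ge>0. \<forall>x\<ge>0. x powr p \<le> C * exp x" if "p \<ge> 0" for p :: real
proof -
  define N where "N = nat \<lceil>p\<rceil>"
  have N: "p \<le> real N" using that by (simp add: N_def)
  show ?thesis
  proof (intro exI[of _ "fact N + 1"] conjI allI impI)
    fix x :: real assume x: "x \<ge> 0"
    show "x powr p \<le> (fact N + 1) * exp x"
    proof (cases "x \<le> 1")
      case True
      have "x powr p \<le> 1 powr p" using x True that by (intro powr_mono2) auto
      also have "\<dots> \<le> (fact N + 1) * exp x"
        using x mult_mono[of 1 "fact N + 1" 1 "exp x"] by simp
      finally show ?thesis .
    next
      case False
      then have "x powr p \<le> x powr real N" using N by (intro powr_mono) auto
      also have "\<dots> = x ^ N" using False by (simp add: powr_realpow)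
      also have "\<dots> \<le> fact N * exp x"
      proof -
        have "(\<Sum>n\<in>{N}. x ^ n /\<^sub>R fact n) \<le> exp x"
          unfolding exp_def by (rule sum_le_suminf[OF summable_exp_generic]) (use x in auto)
        then show ?thesis by (simp add: field_simps)
      qed
      also have "\<dots> \<le> (fact N + 1) * exp x" by (intro mult_right_mono) auto
      finally show ?thesis .
    qed
  qed simp
qed

lemma exp_growth_powr: "p \<ge> 0 \<Longrightarrow> exp_growth (\<lambda>t. \<bar>t - a\<bar> powr p :: real)"
proof -
  assume "p \<ge> 0"
  then obtain C where C: "C \<ge> 0" "\<And>x. x \<ge> 0 \<Longrightarrow> x powr p \<le> C * exp x" using powr_le_exp by blast
  show ?thesis
  proof (rule exp_growthI[of _ "C * exp \<bar>a\<bar>" 1])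
    fix t :: real
    have "\<bar>t - a\<bar> powr p \<le> C * exp \<bar>t - a\<bar>" by (intro C) auto
    also have "\<dots> \<le> C * exp (\<bar>a\<bar> + \<bar>t\<bar>)" using C by (intro mult_left_mono) auto
    finally show "norm (\<bar>t - a\<bar> powr p) \<le> C * exp \<bar>a\<bar> * exp (1 * \<bar>t\<bar>)"
      by (simp add: exp_add)
  qed simp
qed

lemma integrable_exp_neg_sq:
  assumes "0 < a"
  shows "integrable lborel (\<lambda>t::real. exp (- a * t\<^sup>2))"
proof -
  have "2 * (sqrt (1 / (2 * a)))\<^sup>2 = 1 / a" using assms by simp
  then have "integrable lborel (\<lambda>t. sqrt (2 * pi * (sqrt (1 / (2 * a)))\<^sup>2) * normal_density 0 (sqrt (1 / (2 * a))) t)"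
    using assms by (intro integrable_mult_right integrable_normal_density) auto
  also have "(\<lambda>t. sqrt (2 * pi * (sqrt (1 / (2 * a)))\<^sup>2) * normal_density 0 (sqrt (1 / (2 * a))) t)
     = (\<lambda>t. exp (- a * t\<^sup>2))"
    using assms by (auto simp: normal_density_def fun_eq_iff field_simps)
  finally show ?thesis .
qed

text \<open>Half of the Gaussian decay absorbs the exponential growth, by completing the square in
\<open>- a * t\<^sup>2 + c * \<bar>t\<bar>\<close>.\<close>

lemma exp_growth_times_gauss_le:
  assumes "0 < a" "exp_growth \<phi>"
  obtains C where "C \<ge> 0" "\<And>t. norm (exp (- a * t\<^sup>2) *\<^sub>R \<phi> t) \<le> C * exp (- (a/2) * t\<^sup>2)"
proof -
  obtain C c where 1: "C \<ge> 0" "c \<ge> 0" "\<And>t. norm (\<phi> t) \<le> C * exp (c * \<bar>t\<bar>)"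
    using exp_growthE[OF assms(2)] by blast
  have "norm (exp (- a * t\<^sup>2) *\<^sub>R \<phi> t) \<le> (C * exp (c\<^sup>2 / (2*a))) * exp (- (a/2) * t\<^sup>2)" for t
  proof -
    have "0 \<le> (a * \<bar>t\<bar> - c)\<^sup>2 / (2 * a)" using assms by simp
    also have "\<dots> = (a/2) * t\<^sup>2 + c\<^sup>2 / (2*a) - c * \<bar>t\<bar>"
      using assms by (simp add: power2_diff power_mult_distrib add_divide_distrib diff_divide_distrib) (simp add: power2_eq_square)
    finally have *: "- a * t\<^sup>2 + c * \<bar>t\<bar> \<le> c\<^sup>2 / (2*a) + - (a/2) * t\<^sup>2" by (simp add: algebra_simps)
    have "norm (exp (- a * t\<^sup>2) *\<^sub>R \<phi> t) \<le> exp (- a * t\<^sup>2) * (C * exp (c * \<bar>t\<bar>))"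
      using 1 by simp
    also have "\<dots> = C * exp (- a * t\<^sup>2 + c * \<bar>t\<bar>)" by (simp add: mult_exp_exp add.commute)
    also have "\<dots> \<le> C * exp (c\<^sup>2 / (2*a) + - (a/2) * t\<^sup>2)"
      using * 1 by (intro mult_left_mono) auto
    finally show ?thesis by (simp only: exp_add mult_ac)
  qed
  with 1 show ?thesis by (intro that[of "C * exp (c\<^sup>2 / (2*a))"]) auto
qed

lemma integrable_exp_growth:
  fixes \<phi> :: "real \<Rightarrow> 'a::{banach, second_countable_topology}"
  assumes "0 < a" and [measurable]: "exp_growth \<phi>"
  shows "integrable lborel (\<lambda>t. exp (- a * t\<^sup>2) *\<^sub>R \<phi> t)"
proof -
  obtain C where C: "\<And>t. norm (exp (- a * t\<^sup>2) *\<^sub>R \<phi> t) \<le> C * exp (- (a/2) * t\<^sup>2)"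
    using exp_growth_times_gauss_le[OF assms] by blast
  show ?thesis
  proof (rule Bochner_Integration.integrable_bound[where f = "\<lambda>t. C * exp (- (a/2) * t\<^sup>2)"])
    show "integrable lborel (\<lambda>t. C * exp (- (a/2) * t\<^sup>2))"
      using assms by (intro integrable_mult_right integrable_exp_neg_sq) auto
    show "AE t in lborel. norm (exp (- a * t\<^sup>2) *\<^sub>R \<phi> t) \<le> norm (C * exp (- (a/2) * t\<^sup>2))"
      using C by (intro AE_I2) (metis abs_ge_self order_trans real_norm_def)
  qed auto
qed

lemma cmod_gaussian_sq: "(cmod (gaussian t))\<^sup>2 = sqrt 2 * exp (- (2 * pi) * t\<^sup>2)"
proof -
  have "(2 powr (1/4))\<^sup>2 = (2::real) powr (1/2)" by (simp add: power2_eq_square powr_add[symmetric])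
  then show ?thesis
    by (simp add: gaussian_def norm_mult power_mult_distrib powr_half_sqrt exp_double[symmetric])
qed

lemma borel_gaussian [measurable]: "gaussian \<in> borel_measurable borel"
  unfolding gaussian_def[abs_def] by measurable

lemma gaussian_nonzero: "gaussian t \<noteq> 0"
  by (simp add: gaussian_def)

lemma integrable_weighted_gaussian:
  assumes "exp_growth (\<omega> :: real \<Rightarrow> real)" "exp_growth \<phi>"
  shows "integrable lborel (\<lambda>t. \<omega> t * (cmod (\<phi> t * gaussian t))\<^sup>2)"
proof -
  have "integrable lborel (\<lambda>t. exp (- (2*pi) * t\<^sup>2) *\<^sub>R (sqrt 2 * (\<omega> t * (cmod (\<phi> t))\<^sup>2)))"
    by (intro integrable_exp_growth exp_growth_mult exp_growth_const assms exp_growth_norm_sq) auto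
  then show ?thesis by (simp add: norm_mult power_mult_distrib cmod_gaussian_sq mult_ac)
qed

lemma integrable_energy_gaussian:
  assumes "exp_growth \<phi>"
  shows "integrable lborel (\<lambda>t. (cmod (\<phi> t * gaussian t))\<^sup>2)"
  using integrable_weighted_gaussian[OF exp_growth_const[of 1] assms] by simp

lemma exp_growth_gaussian_L2:
  assumes [measurable]: "exp_growth \<phi>"
  shows "(\<lambda>t. \<phi> t * gaussian t) \<in> L2"
  using integrable_energy_gaussian[OF assms]
  unfolding mem_L2_iff energy_def by (auto simp: integrable_iff_bounded)

section \<open>Integration by parts against Gaussian exponentials\<close>

text \<open>Up to a constant factor, \<open>a = 2 * pi\<close> and \<open>b = 0\<close> give the weight \<open>gaussian t ^ 2\<close> of inner
products, and \<open>a = pi\<close> and \<open>b = - 2 * pi * \<xi>\<close> give the kernel of the Fourier integral of the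
Gaussian at \<open>\<xi>\<close>. One integration by parts therefore serves both purposes.\<close>

definition gauss_wave :: "real \<Rightarrow> real \<Rightarrow> real \<Rightarrow> complex" where
  "gauss_wave a b t = of_real (exp (- a * t\<^sup>2)) * exp (\<i> * of_real (b * t))"

definition gauss_integral :: "real \<Rightarrow> real \<Rightarrow> complex poly \<Rightarrow> complex" where
  "gauss_integral a b P = (LINT t|lborel. poly P (of_real t) * gauss_wave a b t)"

lemma norm_gauss_wave: "cmod (gauss_wave a b t) = exp (- a * t\<^sup>2)"
  by (simp add: gauss_wave_def norm_mult)

lemma integrable_poly_gauss_wave:
  assumes "0 < a"
  shows "integrable lborel (\<lambda>t. poly P (of_real t) * gauss_wave a b t)"
proof -
  have "integrable lborel (\<lambda>t. exp (- a * t\<^sup>2) *\<^sub>R (poly P (of_real t) * exp (\<i> * of_real (b * t))))"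
    by (intro integrable_exp_growth assms exp_growth_mult exp_growth_poly exp_growth_bounded[of _ 1])
       (auto simp: borel_measurable_continuous_onI)
  then show ?thesis by (simp add: gauss_wave_def scaleR_conv_of_real mult_ac)
qed

lemma gauss_integral_add: "0 < a \<Longrightarrow> gauss_integral a b (P + Q) = gauss_integral a b P + gauss_integral a b Q"
  unfolding gauss_integral_def by (simp add: ring_distribs integrable_poly_gauss_wave)

lemma gauss_integral_smult: "gauss_integral a b (smult c P) = c * gauss_integral a b P"
  unfolding gauss_integral_def by (simp add: mult.assoc)

lemma gauss_integral_diff: "0 < a \<Longrightarrow> gauss_integral a b (P - Q) = gauss_integral a b P - gauss_integral a b Q"
  unfolding gauss_integral_def by (simp add: ring_distribs integrable_poly_gauss_wave)

lemma has_vector_derivative_poly_gauss_wave: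
  "((\<lambda>t. poly P (of_real t) * gauss_wave a b t) has_vector_derivative
     poly (pderiv P + P * [:\<i> * of_real b, - 2 * of_real a:]) (of_real t) * gauss_wave a b t) (at t within A)"
proof -
  define E where "E = (\<lambda>z::complex. exp (- of_real a * z\<^sup>2 + \<i> * of_real b * z))"
  have E: "gauss_wave a b s = E (of_real s)" for s
    unfolding E_def gauss_wave_def exp_of_real[symmetric] mult_exp_exp by (simp add: mult_ac)
  have "((\<lambda>z. poly P z * E z) has_field_derivative
      poly (pderiv P) z * E z + E z * (- of_real a * (2 * z) + \<i> * of_real b) * poly P z) (at z)" for z
    unfolding E_def by (auto intro!: derivative_eq_intros poly_DERIV)
  then have "((\<lambda>z. poly P z * E z) has_field_derivative
      poly (pderiv P + P * [:\<i> * of_real b, - 2 * of_real a:]) z * E z) (at z)" for z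
    by (simp add: algebra_simps)
  from has_vector_derivative_real_field[OF this] show ?thesis
    unfolding E by simp
qed

lemma continuous_on_poly_gauss_wave: "continuous_on A (\<lambda>t. poly P (of_real t) * gauss_wave a b t)"
  unfolding gauss_wave_def by (intro continuous_intros)

lemma poly_gauss_wave_FTC:
  assumes "R \<ge> 0"
  shows "(LINT t|lborel. indicator {-R..R} t *\<^sub>R
      (poly (pderiv P + P * [:\<i> * of_real b, - 2 * of_real a:]) (of_real t) * gauss_wave a b t))
    = poly P (of_real R) * gauss_wave a b R - poly P (of_real (-R)) * gauss_wave a b (-R)"
  using assms
  by (intro integral_FTC_Icc has_vector_derivative_poly_gauss_wave continuous_on_poly_gauss_wave) auto

lemma poly_gauss_wave_bound:
  assumes "0 < a"
  obtains C where "C \<ge> 0" "\<And>t b. cmod (poly P (of_real t) * gauss_wave a b t) \<le> C * exp (- (a/2) * t\<^sup>2)"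
proof -
  obtain C where C: "C \<ge> 0" "\<And>t. norm (exp (- a * t\<^sup>2) *\<^sub>R poly P (complex_of_real t)) \<le> C * exp (- (a/2) * t\<^sup>2)"
    using exp_growth_times_gauss_le[OF assms exp_growth_poly] by blast
  then show ?thesis
    by (intro that[of C]) (auto simp: norm_mult norm_gauss_wave mult.commute)
qed

lemma exp_neg_sq_tendsto_0: "0 < a \<Longrightarrow> (\<lambda>n. C * exp (- a * (real n)\<^sup>2)) \<longlonglongrightarrow> 0"
  by real_asymp

text \<open>The integrand is the derivative of \<open>P\<close> times the Gaussian wave, which vanishes at both ends.\<close>

lemma gauss_integral_by_parts:
  assumes a: "0 < a"
  shows "gauss_integral a b (pderiv P + P * [:\<i> * of_real b, - 2 * of_real a:]) = 0"
proof -
  let ?D = "\<lambda>t. poly (pderiv P + P * [:\<i> * of_real b, - 2 * of_real a:]) (of_real t) * gauss_wave a b t"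
  let ?F = "\<lambda>t. poly P (of_real t) * gauss_wave a b t"
  have 1: "(\<lambda>n. LINT t|lborel. indicator {-real n..real n} t *\<^sub>R ?D t) \<longlonglongrightarrow> (LINT t|lborel. ?D t)"
  proof (rule integral_dominated_convergence[where w = "\<lambda>t. cmod (?D t)"])
    show "integrable lborel (\<lambda>t. cmod (?D t))"
      by (intro integrable_norm integrable_poly_gauss_wave a)
    show "AE t in lborel. (\<lambda>n. indicator {-real n..real n} t *\<^sub>R ?D t) \<longlonglongrightarrow> ?D t"
    proof (intro AE_I2 tendsto_eventually)
      fix t :: real
      obtain N :: nat where "\<bar>t\<bar> \<le> real N" using real_arch_simple by blast
      then show "\<forall>\<^sub>F n in sequentially. indicator {-real n..real n} t *\<^sub>R ?D t = ?D t"
        by (intro eventually_sequentiallyI[of N]) (auto simp: indicator_def)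
    qed
    show "AE t in lborel. norm (indicator {-real n..real n} t *\<^sub>R ?D t) \<le> cmod (?D t)" for n
      by (intro AE_I2) (auto simp: indicator_def)
  qed (use integrable_poly_gauss_wave[OF a] in \<open>auto simp: borel_measurable_integrable simp del: poly_add poly_mult poly_pCons\<close>)
  obtain C where C: "\<And>t. cmod (?F t) \<le> C * exp (- (a/2) * t\<^sup>2)"
    using poly_gauss_wave_bound[OF a] by metis
  have Fn: "(\<lambda>n. ?F (x n)) \<longlonglongrightarrow> 0" if "\<And>n. (x n)\<^sup>2 = (real n)\<^sup>2" for x :: "nat \<Rightarrow> real"
  proof (rule Lim_null_comparison[OF always_eventually exp_neg_sq_tendsto_0[of "a/2" C]])
    show "\<forall>n. cmod (?F (x n)) \<le> C * exp (- (a/2) * (real n)\<^sup>2)"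
      by (metis C that)
  qed (use a in simp)
  have "(\<lambda>n. ?F (real n) - ?F (- real n)) \<longlonglongrightarrow> 0 - 0"
    by (intro tendsto_diff Fn) auto
  with 1 show ?thesis
    unfolding gauss_integral_def by (subst (asm) poly_gauss_wave_FTC) (auto intro: LIMSEQ_unique)
qed

section \<open>Hermite polynomials\<close>

text \<open>The monic Hermite polynomials for the weight \<open>exp (- 2 * pi * t\<^sup>2)\<close>. The recursion is the raising
operator rather than the three-term recurrence, since it is adjoint to differentiation
under this weight.\<close>

fun hermite :: "nat \<Rightarrow> complex poly" where
  "hermite 0 = 1"
| "hermite (Suc n) = pCons 0 (hermite n) - smult (1 / (4 * of_real pi)) (pderiv (hermite n))"

lemma degree_hermite_le: "degree (hermite n) \<le> n"
proof (induction n)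
  case (Suc n)
  then show ?case
    by (auto intro!: degree_diff_le degree_pCons_le[THEN order_trans] order_trans[OF degree_smult_le] simp: degree_pderiv)
qed simp

lemma coeff_hermite: "coeff (hermite n) n = 1"
proof (induction n)
  case (Suc n)
  have "coeff (hermite n) (Suc (Suc n)) = 0"
    using degree_hermite_le[of n] by (intro coeff_eq_0) auto
  with Suc show ?case by (simp add: coeff_pderiv)
qed simp

text \<open>Integration by parts moves one derivative from the Hermite polynomial to the other factor.\<close>

lemma gauss_integral_hermite_step:
  "gauss_integral (2*pi) 0 (q * hermite (Suc n)) = gauss_integral (2*pi) 0 (pderiv q * hermite n) / (4 * of_real pi)"
proof -
  let ?L = "gauss_integral (2*pi) 0"
  have "pderiv (q * hermite n) + (q * hermite n) * [:\<i> * of_real 0, - 2 * of_real (2*pi):]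
     = (pderiv q * hermite n + q * pderiv (hermite n)) - smult (4 * of_real pi) (q * pCons 0 (hermite n))"
    by (simp add: pderiv_mult mult.commute[of _ "pCons _ _"] mult.commute[of "pderiv _"])
  then have "0 = ?L ((pderiv q * hermite n + q * pderiv (hermite n)) - smult (4 * of_real pi) (q * pCons 0 (hermite n)))"
    using gauss_integral_by_parts[of "2*pi" 0 "q * hermite n"] by simp
  then have *: "?L (pderiv q * hermite n) + ?L (q * pderiv (hermite n)) = 4 * of_real pi * ?L (q * pCons 0 (hermite n))"
    by (simp add: gauss_integral_add gauss_integral_diff gauss_integral_smult del: mult_pCons_right)
  have "?L (q * hermite (Suc n)) = ?L (q * pCons 0 (hermite n)) - ?L (q * pderiv (hermite n)) / (4 * of_real pi)"
  proof -
    have "q * hermite (Suc n) = q * pCons 0 (hermite n) - smult (1 / (4 * of_real pi)) (q * pderiv (hermite n))"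
      by (simp only: hermite.simps right_diff_distrib mult_smult_right)
    then show ?thesis by (simp only: gauss_integral_diff gauss_integral_smult) (simp add: gauss_integral_diff gauss_integral_smult del: mult_pCons_right)
  qed
  with * show ?thesis by (simp add: field_simps del: mult_pCons_right hermite.simps) (metis add_left_imp_eq)
qed

text \<open>After \<open>n\<close> steps only the \<open>n\<close>-th derivative of \<open>q\<close> is left. This gives at once the
orthogonality to lower degrees and the nonvanishing of the integral of \<open>hermite n ^ 2\<close>.\<close>

lemma gauss_integral_hermite:
  "degree q \<le> n \<Longrightarrow> gauss_integral (2*pi) 0 (q * hermite n)
     = coeff q n * fact n / (4 * of_real pi) ^ n * gauss_integral (2*pi) 0 1"
proof (induction n arbitrary: q)
  case 0
  then obtain c where "q = [:c:]" by (metis le_zero_eq degree_eq_zeroE)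
  then show ?case using gauss_integral_smult[of "2*pi" 0 c 1] by simp
next
  case (Suc n)
  have "degree (pderiv q) \<le> n" using Suc.prems by (simp add: degree_pderiv)
  from Suc.IH[OF this] show ?case
    unfolding gauss_integral_hermite_step by (simp add: coeff_pderiv field_simps)
qed

lemma gauss_integral_one_nonzero: "gauss_integral (2*pi) 0 1 \<noteq> 0"
proof -
  have i: "integrable lborel (\<lambda>t::real. exp (- (2*pi) * t\<^sup>2))" by (intro integrable_exp_neg_sq) auto
  have "\<not> (AE t::real in lborel. exp (- (2*pi) * t\<^sup>2) = 0)"
    by (simp add: AE_iff_measurable[OF _ refl] )
  then have "(LINT t::real|lborel. exp (- (2*pi) * t\<^sup>2)) \<noteq> 0"
    using integral_nonneg_eq_0_iff_AE[OF i] by simp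
  moreover have "gauss_integral (2*pi) 0 1 = of_real (LINT t::real|lborel. exp (- (2*pi) * t\<^sup>2))"
    by (simp add: gauss_integral_def gauss_wave_def)
  ultimately show ?thesis by simp
qed

section \<open>Fourier transforms of polynomials times the Gaussian\<close>

text \<open>The substitution \<open>x = sqrt (2 * pi) * t\<close> turns this into the characteristic function of the
standard normal distribution.\<close>

lemma gauss_integral_one: "gauss_integral pi (- 2 * pi * \<xi>) 1 = of_real (exp (- pi * \<xi>\<^sup>2))"
proof -
  define s where "s = sqrt (2 * pi)"
  have s: "s > 0" "s\<^sup>2 = 2 * pi" by (auto simp: s_def)
  have "of_real (exp (- ((- s * \<xi>)\<^sup>2) / 2)) = char std_normal_distribution (- s * \<xi>)"
    by (simp only: char_std_normal_distribution)
  also have "\<dots> = (LINT x|lborel. std_normal_density x *\<^sub>R iexp ((- s * \<xi>) * x))"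
    unfolding char_def by (rule integral_density) auto
  also have "\<dots> = \<bar>s\<bar> *\<^sub>R (LINT x|lborel. std_normal_density (0 + s * x) *\<^sub>R iexp ((- s * \<xi>) * (0 + s * x)))"
    using s by (intro lborel_integral_real_affine) auto
  also have "\<dots> = (LINT x|lborel. \<bar>s\<bar> *\<^sub>R (std_normal_density (0 + s * x) *\<^sub>R iexp ((- s * \<xi>) * (0 + s * x))))"
    by (simp only: integral_scaleR_right)
  also have "\<dots> = (LINT x|lborel. gauss_wave pi (- 2 * pi * \<xi>) x)"
  proof (rule Bochner_Integration.integral_cong[OF refl])
    fix x :: real
    have d: "\<bar>s\<bar> * std_normal_density (0 + s * x) = exp (- pi * x\<^sup>2)"
      using s by (simp add: std_normal_density_def s_def[symmetric] power_mult_distrib)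
    have e: "(- s * \<xi>) * (0 + s * x) = (- 2 * pi * \<xi>) * x"
    proof -
      have "(- s * \<xi>) * (0 + s * x) = - (s\<^sup>2 * \<xi> * x)" by (simp add: power2_eq_square mult_ac)
      then show ?thesis unfolding s(2) by simp
    qed
    show "\<bar>s\<bar> *\<^sub>R (std_normal_density (0 + s * x) *\<^sub>R iexp ((- s * \<xi>) * (0 + s * x))) = gauss_wave pi (- 2 * pi * \<xi>) x"
      unfolding scaleR_scaleR d e gauss_wave_def by (simp add: scaleR_conv_of_real)
  qed
  also have "\<dots> = gauss_integral pi (- 2 * pi * \<xi>) 1"
    by (simp add: gauss_integral_def)
  finally show ?thesis using s by (simp add: power_mult_distrib)
qed

text \<open>Multiplication by \<open>t\<close> on the time side, expressed through polynomials of lower degree. Solving the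
integration by parts formula for its top degree term avoids differentiating under the integral sign.\<close>

lemma gauss_integral_pCons_0:
  "gauss_integral pi (- 2 * pi * \<xi>) (pCons 0 P)
     = gauss_integral pi (- 2 * pi * \<xi>) (pderiv P) / (2 * of_real pi) - \<i> * of_real \<xi> * gauss_integral pi (- 2 * pi * \<xi>) P"
proof -
  let ?J = "gauss_integral pi (- 2 * pi * \<xi>)"
  have "pderiv P + P * [:\<i> * of_real (- 2 * pi * \<xi>), - 2 * of_real pi:]
      = pderiv P + smult (\<i> * of_real (- 2 * pi * \<xi>)) P + smult (- 2 * of_real pi) (pCons 0 P)"
    by simp
  then have "?J (pderiv P) + \<i> * of_real (- 2 * pi * \<xi>) * ?J P + (- 2 * of_real pi) * ?J (pCons 0 P) = 0"
    using gauss_integral_by_parts[of pi "- 2 * pi * \<xi>" P]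
    by (simp only: gauss_integral_add gauss_integral_smult pi_gt_zero)
  then show ?thesis by (simp add: field_simps)
qed

lemma gauss_integral_fourier:
  "\<exists>Q. \<forall>\<xi>. gauss_integral pi (- 2 * pi * \<xi>) P = poly Q (of_real \<xi>) * of_real (exp (- pi * \<xi>\<^sup>2))"
proof (induction "degree P" arbitrary: P rule: less_induct)
  case less
  obtain c p where P: "P = pCons c p" by (cases P)
  have const: "\<exists>Q. \<forall>\<xi>. gauss_integral pi (- 2 * pi * \<xi>) [:c:] = poly Q (of_real \<xi>) * of_real (exp (- pi * \<xi>\<^sup>2))" for c
    using gauss_integral_smult[of pi _ c 1] gauss_integral_one by (intro exI[of _ "[:c:]"]) simp
  show ?case
  proof (cases "p = 0")
    case True
    then show ?thesis using const P by simp
  next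
    case False
    then have d: "degree p < degree P" "degree (pderiv p) < degree P"
      by (auto simp: P degree_pderiv)
    obtain Q1 where Q1: "\<And>\<xi>. gauss_integral pi (- 2 * pi * \<xi>) p = poly Q1 (of_real \<xi>) * of_real (exp (- pi * \<xi>\<^sup>2))"
      using less[OF d(1)] by blast
    obtain Q2 where Q2: "\<And>\<xi>. gauss_integral pi (- 2 * pi * \<xi>) (pderiv p) = poly Q2 (of_real \<xi>) * of_real (exp (- pi * \<xi>\<^sup>2))"
      using less[OF d(2)] by blast
    obtain Q3 where Q3: "\<And>\<xi>. gauss_integral pi (- 2 * pi * \<xi>) [:c:] = poly Q3 (of_real \<xi>) * of_real (exp (- pi * \<xi>\<^sup>2))"
      using const by blast
    have P': "P = [:c:] + pCons 0 p" by (simp add: P)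
    show ?thesis
    proof (intro exI[of _ "Q3 + (smult (1 / (2 * of_real pi)) Q2 - smult \<i> (pCons 0 Q1))"] allI)
      fix \<xi> :: real
      have "gauss_integral pi (- 2 * pi * \<xi>) P
          = gauss_integral pi (- 2 * pi * \<xi>) [:c:] + gauss_integral pi (- 2 * pi * \<xi>) (pCons 0 p)"
        unfolding P' by (rule gauss_integral_add) simp
      then show "gauss_integral pi (- 2 * pi * \<xi>) P
          = poly (Q3 + (smult (1 / (2 * of_real pi)) Q2 - smult \<i> (pCons 0 Q1))) (of_real \<xi>) * of_real (exp (- pi * \<xi>\<^sup>2))"
        unfolding gauss_integral_pCons_0 Q1 Q2 Q3 by (simp add: algebra_simps)
    qed
  qed
qed

text \<open>Measurability in the frequency variable, which comes from Fubini.\<close>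

lemma borel_truncated_fourier [measurable]:
  assumes [measurable]: "h \<in> borel_measurable borel"
  shows "truncated_fourier R h \<in> borel_measurable borel"
proof -
  have "(\<lambda>\<xi>. LINT t|lborel. indicator {-R..R} t *\<^sub>R (h t * exp (- 2 * of_real pi * \<i> * of_real t * of_real \<xi>)))
      \<in> borel_measurable borel"
    by measurable
  then show ?thesis
    by (simp add: truncated_fourier_def[abs_def] set_lebesgue_integral_def)
qed

lemma L2_norm_eq_integral:
  "integrable lborel (\<lambda>t. (cmod (h t))\<^sup>2) \<Longrightarrow> L2_norm h = ennreal (sqrt (LINT t|lborel. (cmod (h t))\<^sup>2))"
  by (simp add: L2_norm_def nn_integral_eq_integral ennreal_sqrt_ennreal)

lemma energy_diff_commute: "energy (u - v) = energy (v - u)"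
  by (simp add: energy_def norm_minus_commute)

text \<open>Both functions are \<open>L2\<close> limits of the same truncations. Hence the representative picked by
\<open>fourier\<close> agrees almost everywhere with any explicitly known transform.\<close>

lemma is_fourier_transform_unique:
  assumes h[measurable]: "h \<in> borel_measurable borel"
    and F: "is_fourier_transform h F" and G: "is_fourier_transform h G"
  shows "AE \<xi> in lborel. F \<xi> = G \<xi>"
proof -
  have m[measurable]: "F \<in> borel_measurable borel" "G \<in> borel_measurable borel"
    using F G by (auto simp: is_fourier_transform_def mem_L2_borel)
  have "energy (F - G) \<le> ennreal d" if "d > 0" for d
  proof -
    have "sqrt (d/4) > 0" using that by simp
    then have "\<forall>\<^sub>F R in at_top. L2_norm (F - truncated_fourier R h) < ennreal (sqrt (d/4))"
      "\<forall>\<^sub>F R in at_top. L2_norm (G - truncated_fourier R h) < ennreal (sqrt (d/4))"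
      using F G unfolding is_fourier_transform_def by (auto intro!: order_tendstoD(2)[of _ 0])
    then have "\<forall>\<^sub>F R in at_top. L2_norm (F - truncated_fourier R h) < ennreal (sqrt (d/4)) \<and>
        L2_norm (G - truncated_fourier R h) < ennreal (sqrt (d/4))"
      by eventually_elim auto
    then obtain R where R: "L2_norm (F - truncated_fourier R h) < ennreal (sqrt (d/4))"
        "L2_norm (G - truncated_fourier R h) < ennreal (sqrt (d/4))"
      by (metis (mono_tags, lifting) eventually_happens' trivial_limit_at_top_linorder)
    have "energy (F - G) \<le> 2 * energy (F - truncated_fourier R h) + 2 * energy (truncated_fourier R h - G)"
      by (intro energy_diff_le) auto
    also have "\<dots> \<le> 2 * ennreal (d/4) + 2 * ennreal (d/4)"
      using R that \<open>sqrt (d/4) > 0\<close>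
      by (intro add_mono mult_left_mono) (auto simp: L2_norm_less_iff energy_diff_commute[of _ G] simp del: real_sqrt_gt_0_iff intro: less_imp_le)
    also have "\<dots> = ennreal d" using that by (intro ennreal_quarters) simp
    finally show ?thesis .
  qed
  then have "energy (F - G) \<le> 0"
    by (metis ennreal_le_epsilon add.left_neutral)
  then have "energy (F - G) = 0" by simp
  then have "AE \<xi> in lborel. ennreal ((cmod ((F - G) \<xi>))\<^sup>2) = 0"
    unfolding energy_def by (subst (asm) nn_integral_0_iff_AE) (auto simp: fun_diff_def)
  then show ?thesis by eventually_elim simp
qed

lemma fourier_AE_eq:
  assumes "h \<in> borel_measurable borel" "is_fourier_transform h F"
  shows "fourier h \<in> L2" "AE \<xi> in lborel. fourier h \<xi> = F \<xi>"
proof -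
  have *: "is_fourier_transform h (fourier h)"
    unfolding fourier_def by (rule someI[of "is_fourier_transform h" F, OF assms(2)])
  then show "fourier h \<in> L2" by (simp add: is_fourier_transform_def)
  show "AE \<xi> in lborel. fourier h \<xi> = F \<xi>"
    by (rule is_fourier_transform_unique[OF assms(1) * assms(2)])
qed

lemma integrable_inverse_one_plus_sq: "integrable lborel (\<lambda>x::real. inverse (1 + x\<^sup>2))"
  using integrable_inverse_1_plus_square by (simp add: set_integrable_def einterval_eq_UNIV)

lemma cmod_set_integral_gauss_wave_le:
  assumes "0 < a"
  shows "cmod (LINT t|lborel. indicator {-R..R} t *\<^sub>R (poly P (of_real t) * gauss_wave a b t))
    \<le> (LINT t|lborel. cmod (poly P (of_real t) * gauss_wave a 0 t))"
proof -
  have "cmod (LINT t|lborel. indicator {-R..R} t *\<^sub>R (poly P (of_real t) * gauss_wave a b t))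
      \<le> (LINT t|lborel. cmod (indicator {-R..R} t *\<^sub>R (poly P (of_real t) * gauss_wave a b t)))"
    by (rule integral_norm_bound)
  also have "\<dots> \<le> (LINT t|lborel. cmod (poly P (of_real t) * gauss_wave a 0 t))"
    by (intro Bochner_Integration.integral_mono' integrable_norm integrable_poly_gauss_wave assms)
       (auto simp: norm_mult norm_gauss_wave indicator_def)
  finally show ?thesis .
qed

text \<open>The decay in \<open>b\<close>, uniform in the truncation \<open>R\<close>, provides the square integrable majorant
which turns pointwise convergence of the truncated Fourier integrals into \<open>L2\<close> convergence; this
takes the place of Plancherel's theorem. For large \<open>\<bar>b\<bar>\<close> it comes from integrating by parts on
\<open>{-R..R}\<close>, where boundary terms and derivative are bounded independently of \<open>R\<close>.\<close>

lemma truncated_gauss_integral_decay: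
  assumes a: "0 < a"
  obtains K where "K \<ge> 0" "\<And>R b. R \<ge> 0 \<Longrightarrow>
     (1 + \<bar>b\<bar>) * cmod (LINT t|lborel. indicator {-R..R} t *\<^sub>R (poly P (of_real t) * gauss_wave a b t)) \<le> K"
proof -
  let ?I = "\<lambda>R b P. LINT t|lborel. indicator {-R..R} t *\<^sub>R (poly P (of_real t) * gauss_wave a b t)"
  let ?N = "\<lambda>P. LINT t|lborel. cmod (poly P (of_real t) * gauss_wave a 0 t)"
  obtain C where C: "C \<ge> 0" "\<And>t b. cmod (poly P (of_real t) * gauss_wave a b t) \<le> C * exp (- (a/2) * t\<^sup>2)"
    using poly_gauss_wave_bound[OF a] by blast
  have C': "cmod (poly P (of_real t) * gauss_wave a b t) \<le> C" for t b
  proof -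
    have "exp (- (a/2) * t\<^sup>2) \<le> 1" using a by simp
    from mult_left_mono[OF this C(1)] C(2)[of t b] show ?thesis by linarith
  qed
  \<comment> \<open>The part of the derivative that does not depend on b.\<close>
  define P' where "P' = pderiv P + P * [:0, - 2 * of_real a:]"
  have "(1 + \<bar>b\<bar>) * cmod (?I R b P) \<le> ?N P + (2 * C + ?N P')" if R: "R \<ge> 0" for R b
  proof -
    have int: "integrable lborel (\<lambda>t. indicator {-R..R} t *\<^sub>R (poly Q (of_real t) * gauss_wave a b t))" for Q
      by (intro integrable_mult_indicator integrable_poly_gauss_wave a) auto
    have eq: "pderiv P + P * [:\<i> * of_real b, - 2 * of_real a:] = P' + smult (\<i> * of_real b) P"
      by (simp add: P'_def)
    have "?I R b (pderiv P + P * [:\<i> * of_real b, - 2 * of_real a:]) = ?I R b P' + \<i> * of_real b * ?I R b P"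
    proof -
      have "indicator {-R..R} t *\<^sub>R (poly (P' + smult (\<i> * of_real b) P) (of_real t) * gauss_wave a b t)
          = indicator {-R..R} t *\<^sub>R (poly P' (of_real t) * gauss_wave a b t)
            + \<i> * of_real b * (indicator {-R..R} t *\<^sub>R (poly P (of_real t) * gauss_wave a b t))" for t
        by (simp add: indicator_def ring_distribs)
      then show ?thesis
        unfolding eq
        by (simp only: Bochner_Integration.integral_add[OF int integrable_mult_right[OF int]] integral_mult_right_zero)
    qed
    with poly_gauss_wave_FTC[OF R, where P = P and a = a and b = b]
    have "(poly P (of_real R) * gauss_wave a b R - poly P (of_real (-R)) * gauss_wave a b (-R))
        = ?I R b P' + \<i> * of_real b * ?I R b P"
      by (rule trans[OF sym])
    then have "\<i> * of_real b * ?I R b P = (poly P (of_real R) * gauss_wave a b R - poly P (of_real (-R)) * gauss_wave a b (-R)) - ?I R b P'"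
      by (simp only: add_diff_cancel_left')
    note ibp = this
    have "\<bar>b\<bar> * cmod (?I R b P) = cmod (\<i> * of_real b * ?I R b P)"
      by (simp only: norm_mult norm_ii mult_1 norm_of_real)
    also have "\<dots> = cmod ((poly P (of_real R) * gauss_wave a b R - poly P (of_real (-R)) * gauss_wave a b (-R)) - ?I R b P')"
      by (simp only: ibp)
    also have "\<dots> \<le> (C + C) + ?N P'"
      by (intro norm_triangle_le_diff add_mono C' cmod_set_integral_gauss_wave_le a)
    finally show ?thesis using cmod_set_integral_gauss_wave_le[OF a, of R P b]
      by (simp add: ring_distribs)
  qed
  then show ?thesis by (intro that[of "?N P + (2 * C + ?N P')"]) (use C in auto)
qed

lemma truncated_fourier_gaussian:
  "truncated_fourier R (\<lambda>t. poly P (of_real t) * gaussian t) \<xi>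
    = of_real (2 powr (1/4)) * (LINT t|lborel. indicator {-R..R} t *\<^sub>R (poly P (of_real t) * gauss_wave pi (- 2 * pi * \<xi>) t))"
proof -
  have *: "indicator {-R..R} t *\<^sub>R (poly P (of_real t) * gaussian t * exp (- 2 * of_real pi * \<i> * of_real t * of_real \<xi>))
      = of_real (2 powr (1/4)) * (indicator {-R..R} t *\<^sub>R (poly P (of_real t) * gauss_wave pi (- 2 * pi * \<xi>) t))" for t
    by (simp add: gaussian_def gauss_wave_def mult_ac)
  show ?thesis
    unfolding truncated_fourier_def set_lebesgue_integral_def *
    by (simp only: integral_mult_right_zero)
qed

text \<open>The truncated integrals converge pointwise to the full one, and the difference is dominated by a
multiple of \<open>1 / (1 + \<xi>\<^sup>2)\<close> in square.\<close>

lemma is_fourier_transform_poly_gaussian: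
  assumes Q: "\<And>\<xi>. gauss_integral pi (- 2 * pi * \<xi>) P = poly Q (of_real \<xi>) * of_real (exp (- pi * \<xi>\<^sup>2))"
  shows "is_fourier_transform (\<lambda>t. poly P (of_real t) * gaussian t) (\<lambda>\<xi>. poly Q (of_real \<xi>) * gaussian \<xi>)"
proof -
  let ?h = "\<lambda>t. poly P (of_real t) * gaussian t"
  let ?F = "\<lambda>\<xi>. poly Q (of_real \<xi>) * gaussian \<xi>"
  let ?I = "\<lambda>R \<xi>. LINT t|lborel. indicator {-R..R} t *\<^sub>R (poly P (of_real t) * gauss_wave pi (- 2 * pi * \<xi>) t)"
  let ?J = "\<lambda>\<xi>. gauss_integral pi (- 2 * pi * \<xi>) P"
  have hm[measurable]: "?h \<in> borel_measurable borel" "?F \<in> borel_measurable borel"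
    using exp_growth_gaussian_L2[OF exp_growth_poly] by (auto intro: mem_L2_borel)
  have F: "?F \<xi> = of_real (2 powr (1/4)) * ?J \<xi>" for \<xi>
    unfolding Q by (simp add: gaussian_def)
  have lim: "((\<lambda>R. ?I R \<xi>) \<longlongrightarrow> ?J \<xi>) at_top" for \<xi>
    unfolding gauss_integral_def
  proof (rule integral_dominated_convergence_at_top[where w = "\<lambda>t. cmod (poly P (of_real t) * gauss_wave pi (- 2 * pi * \<xi>) t)"])
    show "integrable lborel (\<lambda>t. cmod (poly P (of_real t) * gauss_wave pi (- 2 * pi * \<xi>) t))"
      by (intro integrable_norm integrable_poly_gauss_wave) simp
    show "AE t in lborel. ((\<lambda>R. indicator {-R..R} t *\<^sub>R (poly P (of_real t) * gauss_wave pi (- 2 * pi * \<xi>) t))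
        \<longlongrightarrow> poly P (of_real t) * gauss_wave pi (- 2 * pi * \<xi>) t) at_top"
    proof (intro AE_I2 tendsto_eventually)
      fix t :: real
      show "\<forall>\<^sub>F R in at_top. indicator {-R..R} t *\<^sub>R (poly P (of_real t) * gauss_wave pi (- 2 * pi * \<xi>) t)
          = poly P (of_real t) * gauss_wave pi (- 2 * pi * \<xi>) t"
        using eventually_ge_at_top[of "\<bar>t\<bar>"] by eventually_elim (auto simp: indicator_def)
    qed
    show "\<forall>\<^sub>F R in at_top. AE t in lborel. norm (indicator {-R..R} t *\<^sub>R (poly P (of_real t) * gauss_wave pi (- 2 * pi * \<xi>) t))
        \<le> cmod (poly P (of_real t) * gauss_wave pi (- 2 * pi * \<xi>) t)"
      by (intro always_eventually allI AE_I2) (auto simp: indicator_def)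
  qed (use integrable_poly_gauss_wave[of pi P] in \<open>auto simp: borel_measurable_integrable\<close>)
  obtain K where K: "K \<ge> 0" "\<And>R b. R \<ge> 0 \<Longrightarrow>
      (1 + \<bar>b\<bar>) * cmod (LINT t|lborel. indicator {-R..R} t *\<^sub>R (poly P (of_real t) * gauss_wave pi b t)) \<le> K"
    using truncated_gauss_integral_decay[of pi P] by (metis pi_gt_zero)
  have KJ: "(1 + \<bar>- 2 * pi * \<xi>\<bar>) * cmod (?J \<xi>) \<le> K" for \<xi>
  proof (rule tendsto_upperbound[OF tendsto_mult[OF tendsto_const tendsto_norm[OF lim]]])
    show "\<forall>\<^sub>F R in at_top. (1 + \<bar>- 2 * pi * \<xi>\<bar>) * cmod (?I R \<xi>) \<le> K"
      using eventually_ge_at_top[of 0] by eventually_elim (rule K)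
  qed simp
  let ?D = "\<lambda>R \<xi>. ?F \<xi> - truncated_fourier R ?h \<xi>"
  have D: "?D R \<xi> = of_real (2 powr (1/4)) * (?J \<xi> - ?I R \<xi>)" for R \<xi>
    unfolding F truncated_fourier_gaussian by (simp add: right_diff_distrib)
  define c where "c = (2 powr (1/4) :: real)"
  define M where "M = (c * (2 * K))\<^sup>2"
  have bound: "(cmod (?D R \<xi>))\<^sup>2 \<le> M * inverse (1 + \<xi>\<^sup>2)" if R: "R \<ge> 0" for R \<xi>
  proof -
    have "(1 + \<bar>- 2 * pi * \<xi>\<bar>) * cmod (?J \<xi> - ?I R \<xi>) \<le> (1 + \<bar>- 2 * pi * \<xi>\<bar>) * (cmod (?J \<xi>) + cmod (?I R \<xi>))"
      by (intro mult_left_mono norm_triangle_ineq4) auto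
    also have "\<dots> \<le> 2 * K"
      using KJ[of \<xi>] K(2)[OF R, of "- 2 * pi * \<xi>"] by (simp add: ring_distribs)
    finally have "(1 + \<bar>- 2 * pi * \<xi>\<bar>) * cmod (?D R \<xi>) \<le> c * (2 * K)"
      unfolding D norm_mult c_def by (simp add: mult.left_commute)
    then have "((1 + \<bar>- 2 * pi * \<xi>\<bar>) * cmod (?D R \<xi>))\<^sup>2 \<le> M"
      unfolding M_def by (intro power_mono) auto
    moreover have "1 + \<xi>\<^sup>2 \<le> (1 + \<bar>- 2 * pi * \<xi>\<bar>)\<^sup>2"
    proof -
      have "\<bar>\<xi>\<bar> \<le> \<bar>- 2 * pi * \<xi>\<bar>" using pi_ge_two mult_right_mono[of 1 "2*pi" "\<bar>\<xi>\<bar>"] by (simp add: abs_mult)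
      then have "\<bar>\<xi>\<bar>\<^sup>2 \<le> \<bar>- 2 * pi * \<xi>\<bar>\<^sup>2" by (intro power_mono) auto
      then show ?thesis by (simp add: power2_sum)
    qed
    then have "(1 + \<xi>\<^sup>2) * (cmod (?D R \<xi>))\<^sup>2 \<le> ((1 + \<bar>- 2 * pi * \<xi>\<bar>) * cmod (?D R \<xi>))\<^sup>2"
      unfolding power_mult_distrib by (intro mult_right_mono) auto
    ultimately have "(1 + \<xi>\<^sup>2) * (cmod (?D R \<xi>))\<^sup>2 \<le> M" by linarith
    moreover have "1 + \<xi>\<^sup>2 > 0" by (simp add: add_pos_nonneg)
    ultimately show ?thesis by (simp add: field_simps)
  qed
  have int: "integrable lborel (\<lambda>\<xi>. (cmod (?D R \<xi>))\<^sup>2)" if "R \<ge> 0" for R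
    by (rule Bochner_Integration.integrable_bound[OF integrable_mult_right[OF integrable_inverse_one_plus_sq, of M]])
       (use bound[OF that] in \<open>auto intro!: order_trans[OF _ abs_ge_self]\<close>)
  have "((\<lambda>R. LINT \<xi>|lborel. (cmod (?D R \<xi>))\<^sup>2) \<longlongrightarrow> (LINT \<xi>::real|lborel. (0::real))) at_top"
  proof (rule integral_dominated_convergence_at_top[where w = "\<lambda>\<xi>. M * inverse (1 + \<xi>\<^sup>2)"])
    show "integrable lborel (\<lambda>\<xi>. M * inverse (1 + \<xi>\<^sup>2))"
      by (intro integrable_mult_right integrable_inverse_one_plus_sq)
    show "AE \<xi> in lborel. ((\<lambda>R. (cmod (?D R \<xi>))\<^sup>2) \<longlongrightarrow> 0) at_top"
    proof (intro AE_I2)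
      fix \<xi> :: real
      have "((\<lambda>R. (cmod (of_real (2 powr (1/4)) * (?J \<xi> - ?I R \<xi>)))\<^sup>2)
          \<longlongrightarrow> (cmod (of_real (2 powr (1/4)) * (?J \<xi> - ?J \<xi>)))\<^sup>2) at_top"
        by (intro tendsto_intros lim)
      then show "((\<lambda>R. (cmod (?D R \<xi>))\<^sup>2) \<longlongrightarrow> 0) at_top"
        unfolding D by simp
    qed
    show "\<forall>\<^sub>F R in at_top. AE \<xi> in lborel. norm ((cmod (?D R \<xi>))\<^sup>2) \<le> M * inverse (1 + \<xi>\<^sup>2)"
      using eventually_ge_at_top[of 0] by eventually_elim (use bound in auto)
  qed auto
  then have "((\<lambda>R. ennreal (sqrt (LINT \<xi>|lborel. (cmod (?D R \<xi>))\<^sup>2))) \<longlongrightarrow> ennreal (sqrt 0)) at_top"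
    by (intro tendsto_ennrealI tendsto_real_sqrt) simp
  moreover have "\<forall>\<^sub>F R in at_top. ennreal (sqrt (LINT \<xi>|lborel. (cmod (?D R \<xi>))\<^sup>2)) = L2_norm (?F - truncated_fourier R ?h)"
    using eventually_ge_at_top[of 0]
  proof eventually_elim
    case (elim R)
    then show ?case using int[OF elim] L2_norm_eq_integral[of "?F - truncated_fourier R ?h"] by simp
  qed
  ultimately have "((\<lambda>R. L2_norm (?F - truncated_fourier R ?h)) \<longlongrightarrow> 0) at_top"
    by (simp add: tendsto_cong)
  then show ?thesis
    unfolding is_fourier_transform_def using exp_growth_gaussian_L2[OF exp_growth_poly] by auto
qed

section \<open>Polynomials times the Gaussian span a dense subspace\<close>

text \<open>The span of the polynomials times the Gaussian is shown to be dense in the form in which it is used: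
a closed span that contains them is all of \<open>L2\<close>. In stages, it contains
\<open>F * gaussian\<close> for \<open>F\<close> a polynomial in \<open>sin (c * t)\<close>, then a bounded continuous function, then the
indicator function of a Borel set, then any Borel function for which the product is in \<open>L2\<close>.\<close>

locale gaussian_polys_in_closed_span =
  fixes S :: "(real \<Rightarrow> complex) set"
  assumes S: "S \<subseteq> L2"
    and poly_gaussian: "\<And>P. (\<lambda>t. poly P (complex_of_real t) * gaussian t) \<in> L2_closed_span S"
begin

abbreviation "V \<equiv> L2_closed_span S"

lemma V_add: "u \<in> V \<Longrightarrow> v \<in> V \<Longrightarrow> (\<lambda>t. u t + v t) \<in> V"
  using closed_span_add[OF S, of u v] by (simp add: plus_fun_def)

lemma V_diff: "u \<in> V \<Longrightarrow> v \<in> V \<Longrightarrow> (\<lambda>t. u t - v t) \<in> V"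
  using closed_span_diff[OF S, of u v] by (simp add: fun_diff_def)

lemma V_scale: "u \<in> V \<Longrightarrow> (\<lambda>t. c * u t) \<in> V"
  using closed_span_scale[OF S, of u c] by (simp add: fun_scale_def)

lemma V_zero: "(\<lambda>t. 0) \<in> V"
  using closed_span_zero[OF S] by (simp add: zero_fun_def)

lemma V_sum: "(\<And>i. i \<in> I \<Longrightarrow> u i \<in> V) \<Longrightarrow> (\<lambda>t. \<Sum>i\<in>I. u i t) \<in> V"
  by (induction I rule: infinite_finite_induct) (auto simp: V_zero V_add)

lemmas V_limit = closed_span_dominated_limit[OF S]

text \<open>Polynomials cannot approximate a bounded function uniformly on the line, so one passes through
\<open>sin (c * t)\<close>, which is bounded and has an everywhere convergent power series. To multiply by
it repeatedly, a function must stay in the closed span after multiplication by every power of \<open>t\<close>;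
the growth bound supplies the majorants.\<close>

definition tame :: "(real \<Rightarrow> complex) set" where
  "tame = {u. exp_growth u \<and> (\<forall>n. (\<lambda>t. u t * of_real t ^ n * gaussian t) \<in> V)}"

definition multiplier :: "(real \<Rightarrow> real) \<Rightarrow> bool" where
  "multiplier \<phi> \<longleftrightarrow> (\<forall>u\<in>tame. (\<lambda>t. of_real (\<phi> t) * u t) \<in> tame)"

lemma one_tame: "(\<lambda>t. 1) \<in> tame"
proof -
  have "(\<lambda>t. of_real t ^ n * gaussian t) \<in> V" for n
    using poly_gaussian[of "monom 1 n"] by (simp add: poly_monom)
  then show ?thesis by (simp add: tame_def exp_growth_const)
qed

lemma multiplier_in_V: "multiplier \<phi> \<Longrightarrow> (\<lambda>t. of_real (\<phi> t) * gaussian t) \<in> V"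
proof -
  assume "multiplier \<phi>"
  then have "(\<lambda>t. of_real (\<phi> t) * 1) \<in> tame" using one_tame unfolding multiplier_def by (rule bspec)
  then have "(\<lambda>t. of_real (\<phi> t) * 1 * of_real t ^ 0 * gaussian t) \<in> V" unfolding tame_def by blast
  then show ?thesis by simp
qed

lemma multiplier_const: "multiplier (\<lambda>_. c)"
proof -
  have "(\<lambda>t. of_real c * u t) \<in> tame" if "u \<in> tame" for u
    using that V_scale[of _ "of_real c"] exp_growth_mult[OF exp_growth_const[of "of_real c"], of u]
    unfolding tame_def by (simp add: mult.assoc)
  then show ?thesis by (simp add: multiplier_def)
qed

lemma multiplier_add: "multiplier \<phi> \<Longrightarrow> multiplier \<psi> \<Longrightarrow> multiplier (\<lambda>t. \<phi> t + \<psi> t)"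
proof -
  assume *: "multiplier \<phi>" "multiplier \<psi>"
  have "(\<lambda>t. of_real (\<phi> t + \<psi> t) * u t) \<in> tame" if "u \<in> tame" for u
    using * that exp_growth_add[of "\<lambda>t. of_real (\<phi> t) * u t" "\<lambda>t. of_real (\<psi> t) * u t"]
      V_add[of "\<lambda>t. of_real (\<phi> t) * u t * of_real t ^ _ * gaussian t" "\<lambda>t. of_real (\<psi> t) * u t * of_real t ^ _ * gaussian t"]
    unfolding multiplier_def tame_def by (simp add: ring_distribs)
  then show ?thesis by (simp add: multiplier_def)
qed

lemma multiplier_mult: "multiplier \<phi> \<Longrightarrow> multiplier \<psi> \<Longrightarrow> multiplier (\<lambda>t. \<phi> t * \<psi> t)"
  unfolding multiplier_def by (simp add: mult.assoc)

lemma sum_sin_coeff_le: "\<bar>\<Sum>m<N. sin_coeff m * x ^ m\<bar> \<le> exp \<bar>x\<bar>"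
proof -
  have "\<bar>\<Sum>m<N. sin_coeff m * x ^ m\<bar> \<le> (\<Sum>m<N. \<bar>x\<bar> ^ m /\<^sub>R fact m)"
  proof (rule order_trans[OF sum_abs sum_mono])
    fix m
    have "\<bar>sin_coeff m\<bar> \<le> 1 / fact m" by (simp add: sin_coeff_def)
    then show "\<bar>sin_coeff m * x ^ m\<bar> \<le> \<bar>x\<bar> ^ m /\<^sub>R fact m"
      using mult_right_mono[of "\<bar>sin_coeff m\<bar>" "1 / fact m" "\<bar>x\<bar> ^ m"]
      by (simp add: abs_mult power_abs divide_inverse)
  qed
  also have "\<dots> \<le> exp \<bar>x\<bar>"
    unfolding exp_def by (rule sum_le_suminf[OF summable_exp_generic]) auto
  finally show ?thesis .
qed

text \<open>The Taylor polynomials of \<open>sin (c * t)\<close> are dominated by \<open>exp (\<bar>c\<bar> * \<bar>t\<bar>)\<close>, which remains square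
integrable against the Gaussian.\<close>

lemma multiplier_sin: "multiplier (\<lambda>t. sin (c * t))"
  unfolding multiplier_def
proof
  fix u assume u: "u \<in> tame"
  then have eg: "exp_growth u" and inV: "\<And>n. (\<lambda>t. u t * of_real t ^ n * gaussian t) \<in> V"
    by (auto simp: tame_def)
  have "exp_growth (\<lambda>t. of_real (sin (c * t)) * u t)"
    by (intro exp_growth_mult exp_growth_bounded[of _ 1] eg) auto
  moreover have "(\<lambda>t. of_real (sin (c * t)) * u t * of_real t ^ n * gaussian t) \<in> V" for n
  proof (rule V_limit[where v = "\<lambda>N t. of_real (\<Sum>m<N. sin_coeff m * (c * t) ^ m) * u t * of_real t ^ n * gaussian t"
        and w = "\<lambda>t. of_real (exp (\<bar>c\<bar> * \<bar>t\<bar>)) * u t * of_real t ^ n * gaussian t"])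
    fix N
    have "(\<lambda>t. \<Sum>m<N. of_real (sin_coeff m * c ^ m) * (u t * of_real t ^ (m + n) * gaussian t)) \<in> V"
      by (intro V_sum V_scale inV)
    then show "(\<lambda>t. of_real (\<Sum>m<N. sin_coeff m * (c * t) ^ m) * u t * of_real t ^ n * gaussian t) \<in> V"
      by (simp add: sum_distrib_right sum_distrib_left power_mult_distrib power_add mult_ac)
  next
    fix t
    have "(\<lambda>N. \<Sum>m<N. sin_coeff m * (c * t) ^ m) \<longlonglongrightarrow> sin (c * t)"
      using sin_converges[of "c * t"] by (simp add: sums_def)
    then show "(\<lambda>N. of_real (\<Sum>m<N. sin_coeff m * (c * t) ^ m) * u t * of_real t ^ n * gaussian t)
        \<longlonglongrightarrow> of_real (sin (c * t)) * u t * of_real t ^ n * gaussian t"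
      by (intro tendsto_intros)
  next
    fix N t
    have "cmod (of_real (\<Sum>m<N. sin_coeff m * (c * t) ^ m)) \<le> cmod (of_real (exp (\<bar>c\<bar> * \<bar>t\<bar>)))"
      using sum_sin_coeff_le[where x = "c * t" and N = N] by (simp only: norm_of_real abs_mult abs_exp_cancel)
    then show "cmod (of_real (\<Sum>m<N. sin_coeff m * (c * t) ^ m) * u t * of_real t ^ n * gaussian t)
        \<le> cmod (of_real (exp (\<bar>c\<bar> * \<bar>t\<bar>)) * u t * of_real t ^ n * gaussian t)"
      unfolding norm_mult by (intro mult_right_mono) auto
  next
    have "exp_growth (\<lambda>t. complex_of_real (exp (\<bar>c\<bar> * \<bar>t\<bar>)) * u t * of_real t ^ n)"
      using exp_growth_poly[of "monom 1 n"]
      by (intro exp_growth_mult eg exp_growth_mono[OF exp_growth_exp[of "\<bar>c\<bar>"], of "\<lambda>t. complex_of_real (exp (\<bar>c\<bar> * \<bar>t\<bar>))"])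
         (auto simp: poly_monom)
    from exp_growth_gaussian_L2[OF this]
    show "(\<lambda>t. of_real (exp (\<bar>c\<bar> * \<bar>t\<bar>)) * u t * of_real t ^ n * gaussian t) \<in> L2" .
  qed
  ultimately show "(\<lambda>t. of_real (sin (c * t)) * u t) \<in> tame" by (simp add: tame_def)
qed

lemma multiplier_polynomial:
  "real_polynomial_function p \<Longrightarrow> multiplier \<phi> \<Longrightarrow> multiplier (\<lambda>t. p (\<phi> t))"
proof (induction p rule: real_polynomial_function.induct)
  case (linear f)
  have f1: "f x = x * f 1" for x
    using linear_scale[OF bounded_linear.linear[OF linear(1)], of x 1] by simp
  have "(\<lambda>t. f (\<phi> t)) = (\<lambda>t. \<phi> t * f 1)" by (intro ext) (rule f1)
  then show ?case using multiplier_mult[OF linear(2) multiplier_const] by simp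
qed (auto intro: multiplier_const multiplier_add multiplier_mult)

lemma gaussian_L2: "(\<lambda>t. of_real c * gaussian t) \<in> L2"
  using exp_growth_gaussian_L2[OF exp_growth_const[of "of_real c"]] .

text \<open>The theorem of Weierstrass on \<open>{-1..1}\<close>, composed with the sine: the approximation is uniform on the
whole line because the sine takes all its values in that interval.\<close>

lemma continuous_sin_in_V:
  fixes F :: "real \<Rightarrow> real"
  assumes F: "continuous_on UNIV F" and B: "\<And>x. \<bar>F x\<bar> \<le> B"
  shows "(\<lambda>t. of_real (F (sin (c * t) / c)) * gaussian t) \<in> V"
proof -
  have "continuous_on {-1..1::real} (\<lambda>x. F (x / c))"
    unfolding divide_inverse by (intro continuous_on_compose2[OF F] continuous_intros) auto
  note cont = this
  have "\<exists>p. real_polynomial_function p \<and> (\<forall>x\<in>{-1..1}. \<bar>F (x / c) - p x\<bar> < 1 / real (Suc n))" for n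
    by (rule Stone_Weierstrass_real_polynomial_function[of "{-1..1::real}" "\<lambda>x. F (x / c)" "1 / real (Suc n)", OF _ cont])
       (blast | simp)+
  then obtain p where p: "\<And>n. real_polynomial_function (p n)"
    "\<And>n x. x \<in> {-1..1} \<Longrightarrow> \<bar>F (x / c) - p n x\<bar> < 1 / real (Suc n)"
    by metis
  have close: "\<bar>F (sin (c * t) / c) - p n (sin (c * t))\<bar> < 1 / real (Suc n)" for n t
    by (rule p(2)) simp
  show ?thesis
  proof (rule V_limit[where v = "\<lambda>n t. of_real (p n (sin (c * t))) * gaussian t" and w = "\<lambda>t. of_real (B + 1) * gaussian t"])
    show "(\<lambda>t. of_real (p n (sin (c * t))) * gaussian t) \<in> V" for n
      by (rule multiplier_in_V[OF multiplier_polynomial[OF p(1) multiplier_sin]])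
    show "(\<lambda>n. of_real (p n (sin (c * t))) * gaussian t) \<longlonglongrightarrow> of_real (F (sin (c * t) / c)) * gaussian t" for t
    proof -
      have "(\<lambda>n. F (sin (c * t) / c) - p n (sin (c * t))) \<longlonglongrightarrow> 0"
      proof (rule Lim_null_comparison[OF always_eventually LIMSEQ_Suc[OF lim_1_over_n]], intro allI)
        show "norm (F (sin (c * t) / c) - p n (sin (c * t))) \<le> 1 / real (Suc n)" for n
          using close[of t n] by (simp only: real_norm_def)
      qed
      then have "(\<lambda>n. F (sin (c * t) / c) - (F (sin (c * t) / c) - p n (sin (c * t)))) \<longlonglongrightarrow> F (sin (c * t) / c) - 0"
        by (intro tendsto_diff tendsto_const)
      then show ?thesis by (intro tendsto_intros) simp
    qed
    show "cmod (of_real (p n (sin (c * t))) * gaussian t) \<le> cmod (of_real (B + 1) * gaussian t)" for n t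
    proof -
      have "1 / real (Suc n) \<le> 1" by simp
      then have "\<bar>p n (sin (c * t))\<bar> \<le> \<bar>B + 1\<bar>" using close[of t n] B[of "sin (c * t) / c"] by linarith
      then show ?thesis unfolding norm_mult norm_of_real by (intro mult_right_mono) auto
    qed
  qed (rule gaussian_L2)
qed

text \<open>As \<open>c\<close> tends to \<open>0\<close>, \<open>sin (c * t) / c\<close> tends to \<open>t\<close>.\<close>

lemma bounded_continuous_in_V:
  fixes F :: "real \<Rightarrow> real"
  assumes F: "continuous_on UNIV F" and B: "\<And>x. \<bar>F x\<bar> \<le> B"
  shows "(\<lambda>t. of_real (F t) * gaussian t) \<in> V"
proof (rule V_limit[where v = "\<lambda>k t. of_real (F (sin (1 / real (Suc k) * t) / (1 / real (Suc k)))) * gaussian t"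
      and w = "\<lambda>t. of_real B * gaussian t"])
  show "(\<lambda>t. of_real (F (sin (1 / real (Suc k) * t) / (1 / real (Suc k)))) * gaussian t) \<in> V" for k
    by (rule continuous_sin_in_V[OF F B])
  show "(\<lambda>k. of_real (F (sin (1 / real (Suc k) * t) / (1 / real (Suc k)))) * gaussian t) \<longlonglongrightarrow> of_real (F t) * gaussian t" for t
  proof -
    have "(\<lambda>k. sin (1 / real (Suc k) * t) / (1 / real (Suc k))) \<longlonglongrightarrow> t"
      by real_asymp
    moreover have "isCont F t" using F by (simp add: continuous_on_eq_continuous_at)
    ultimately show ?thesis by (intro tendsto_intros isCont_tendsto_compose[of t F])
  qed
  show "cmod (of_real (F (sin (1 / real (Suc k) * t) / (1 / real (Suc k)))) * gaussian t) \<le> cmod (of_real B * gaussian t)" for k t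
  proof -
    have "\<bar>F (sin (1 / real (Suc k) * t) / (1 / real (Suc k)))\<bar> \<le> \<bar>B\<bar>" using B order_trans abs_ge_self by blast
    then show ?thesis unfolding norm_mult norm_of_real by (intro mult_right_mono) auto
  qed
qed (rule gaussian_L2)

lemma atMost_in_V: "(\<lambda>t. of_real (indicator {..a} t) * gaussian t) \<in> V"
proof (rule V_limit[where v = "\<lambda>n t. of_real (max 0 (1 - real n * max 0 (t - a))) * gaussian t"
      and w = "\<lambda>t. of_real 1 * gaussian t"])
  show "(\<lambda>t. of_real (max 0 (1 - real n * max 0 (t - a))) * gaussian t) \<in> V" for n
    by (rule bounded_continuous_in_V[of _ 1]) (auto intro!: continuous_intros)
  show "(\<lambda>n. of_real (max 0 (1 - real n * max 0 (t - a))) * gaussian t) \<longlonglongrightarrow> of_real (indicator {..a} t) * gaussian t" for t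
  proof (cases "t \<le> a")
    case False
    then have "(\<lambda>n. max 0 (1 - real n * (t - a))) \<longlonglongrightarrow> 0"
    proof (intro tendsto_eventually)
      obtain N :: nat where N: "1 / (t - a) \<le> real N" using real_arch_simple by blast
      show "\<forall>\<^sub>F n in sequentially. max 0 (1 - real n * (t - a)) = 0"
      proof (rule eventually_sequentiallyI[of N])
        fix n assume "N \<le> n"
        then have "1 / (t - a) \<le> real n" using N by linarith
        then show "max 0 (1 - real n * (t - a)) = 0" using False by (simp add: field_simps)
      qed
    qed
    with False have "(\<lambda>n. complex_of_real (max 0 (1 - real n * max 0 (t - a))) * gaussian t) \<longlonglongrightarrow> of_real 0 * gaussian t"
      by (intro tendsto_intros) simp
    with False show ?thesis by simp
  qed simp
  show "cmod (of_real (max 0 (1 - real n * max 0 (t - a))) * gaussian t) \<le> cmod (of_real 1 * gaussian t)" for n t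
    unfolding norm_mult norm_of_real by (intro mult_right_mono) auto
qed (rule gaussian_L2)

text \<open>The sets in question form a Dynkin system that contains the half-lines, which are stable under
intersection and generate the Borel sets.\<close>

lemma indicator_in_V:
  assumes "A \<in> sets borel"
  shows "(\<lambda>t. of_real (indicator A t) * gaussian t) \<in> V"
proof -
  have "Int_stable (range (\<lambda>a::real. {..a}))" by (auto simp: Int_stable_def)
  moreover have "range (\<lambda>a::real. {..a}) \<subseteq> Pow UNIV" by simp
  moreover have "A \<in> sigma_sets UNIV (range (\<lambda>a::real. {..a}))"
    using assms by (simp add: borel_eq_atMost)
  ultimately show ?thesis
  proof (induction A rule: sigma_sets_induct_disjoint)
    case (basic A)
    then show ?case using atMost_in_V by auto
  next
    case empty
    then show ?case using V_zero by simp
  next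
    case (compl A)
    have "(\<lambda>t. of_real (indicator (UNIV - A) t) * gaussian t)
        = (\<lambda>t. of_real 1 * gaussian t - of_real (indicator A t) * gaussian t)"
      by (auto simp: fun_eq_iff indicator_def)
    with V_diff[OF multiplier_in_V[OF multiplier_const[of 1]] compl(2)] show ?case by simp
  next
    case (union A)
    have fin: "(\<lambda>t. of_real (indicator (\<Union>i<n. A i) t) * gaussian t) \<in> V" for n
    proof (induction n)
      case (Suc n)
      have "A n \<inter> A i = {}" if "i < n" for i
        by (rule disjoint_family_onD[OF union(1)]) (use that in auto)
      then have "A n \<inter> (\<Union>i<n. A i) = {}" by blast
      then have "(\<lambda>t. complex_of_real (indicator (\<Union>i<Suc n. A i) t) * gaussian t)
         = (\<lambda>t. of_real (indicator (\<Union>i<n. A i) t) * gaussian t + of_real (indicator (A n) t) * gaussian t)"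
        by (auto simp: fun_eq_iff indicator_def less_Suc_eq)
      with V_add[OF Suc union(3)] show ?case by simp
    qed (simp add: V_zero)
    show ?case
    proof (rule V_limit[where w = "\<lambda>t. of_real 1 * gaussian t", OF fin])
      show "(\<lambda>n. complex_of_real (indicator (\<Union>i<n. A i) t) * gaussian t) \<longlonglongrightarrow> of_real (indicator (\<Union>i. A i) t) * gaussian t" for t
        by (intro tendsto_intros LIMSEQ_indicator_UN)
      show "cmod (of_real (indicator (\<Union>i<n. A i) t) * gaussian t) \<le> cmod (of_real 1 * gaussian t)" for n t
        unfolding norm_mult norm_of_real by (intro mult_right_mono) (auto simp: indicator_def)
    qed (rule gaussian_L2)
  qed
qed

lemma nonneg_in_V:
  fixes \<phi> :: "real \<Rightarrow> real"
  assumes "\<phi> \<in> borel_measurable borel" "\<And>t. 0 \<le> \<phi> t" "(\<lambda>t. of_real (\<phi> t) * gaussian t) \<in> L2"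
  shows "(\<lambda>t. of_real (\<phi> t) * gaussian t) \<in> V"
  using assms
proof (induction \<phi> rule: borel_measurable_induct_real)
  case (set A)
  then show ?case by (intro indicator_in_V)
next
  case (mult \<phi> c)
  show ?case
  proof (cases "c = 0")
    case False
    have "(\<lambda>t. of_real (1/c) * (of_real (c * \<phi> t) * gaussian t)) \<in> L2"
      using L2_scale[OF mult.prems, of "of_real (1/c)"] by (simp add: fun_scale_def)
    then have "(\<lambda>t. of_real (\<phi> t) * gaussian t) \<in> L2" using False by simp
    from V_scale[OF mult.IH[OF this], of "of_real c"] show ?thesis by (simp add: mult.assoc)
  qed (simp add: V_zero)
next
  case (add \<phi> \<psi>)
  have "(\<lambda>t. of_real (\<phi> t) * gaussian t) \<in> L2" "(\<lambda>t. of_real (\<psi> t) * gaussian t) \<in> L2"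
    by (rule L2_dominated[OF _ _ add.prems];
        use add in \<open>auto simp: norm_mult simp del: of_real_add intro!: mult_right_mono borel_measurable_times borel_measurable_of_real borel_gaussian\<close>)+
  from V_add[OF add.IH(2)[OF this(2)] add.IH(1)[OF this(1)]] show ?case by (simp add: ring_distribs)
next
  case (seq U)
  have le: "U i t \<le> \<phi> t" for i t
    using seq(3,4) by (intro incseq_le[of "\<lambda>i. U i t"]) (auto simp: incseq_def le_fun_def)
  have dom: "cmod (of_real (U i t) * gaussian t) \<le> cmod (of_real (\<phi> t) * gaussian t)" for i t
    using le[of i t] seq(2)[of i t] unfolding norm_mult by (intro mult_right_mono) auto
  have "(\<lambda>t. of_real (U i t) * gaussian t) \<in> L2" for i
    by (rule L2_dominated[OF _ dom seq.prems]) (use seq(1) in measurable)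
  then have inV: "(\<lambda>t. of_real (U i t) * gaussian t) \<in> V" for i
    by (rule seq.IH)
  show ?case
    by (rule V_limit[OF inV _ dom seq.prems]) (intro tendsto_intros, use seq in auto)
qed

text \<open>Divide by the Gaussian, which has no zeros, and split the quotient into the positive and negative
parts of its real and imaginary parts.\<close>

lemma V_eq_L2: "V = L2"
proof
  show "L2 \<subseteq> V"
  proof
    fix u assume u: "u \<in> L2"
    note [measurable] = mem_L2_borel[OF u]
    define w where "w = (\<lambda>t. u t / gaussian t)"
    have w: "u t = w t * gaussian t" for t by (simp add: w_def gaussian_nonzero)
    have [measurable]: "w \<in> borel_measurable borel" unfolding w_def by measurable
    have *: "(\<lambda>t. of_real (max 0 (r (w t))) * gaussian t) \<in> V"
      if [measurable]: "r \<in> borel_measurable borel" and r: "\<And>z. \<bar>r z\<bar> \<le> cmod z" for r :: "complex \<Rightarrow> real"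
    proof (rule nonneg_in_V)
      show "(\<lambda>t. of_real (max 0 (r (w t))) * gaussian t) \<in> L2"
      proof (rule L2_dominated[OF _ _ u])
        show "cmod (of_real (max 0 (r (w t))) * gaussian t) \<le> cmod (u t)" for t
          unfolding w norm_mult norm_of_real using r[of "w t"] by (intro mult_right_mono) auto
      qed measurable
    qed auto
    have "(\<lambda>t. (of_real (max 0 (Re (w t))) * gaussian t - of_real (max 0 (- Re (w t))) * gaussian t)
        + \<i> * (of_real (max 0 (Im (w t))) * gaussian t - of_real (max 0 (- Im (w t))) * gaussian t)) \<in> V"
      by (intro V_add V_diff V_scale *) (auto simp: abs_Re_le_cmod abs_Im_le_cmod)
    also have "(\<lambda>t. (of_real (max 0 (Re (w t))) * gaussian t - of_real (max 0 (- Re (w t))) * gaussian t)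
        + \<i> * (of_real (max 0 (Im (w t))) * gaussian t - of_real (max 0 (- Im (w t))) * gaussian t)) = u"
    proof
      fix t
      have "w t = of_real (max 0 (Re (w t)) - max 0 (- Re (w t))) + \<i> * of_real (max 0 (Im (w t)) - max 0 (- Im (w t)))"
        by (auto simp: complex_eq_iff max_def)
      then have "u t = (of_real (max 0 (Re (w t)) - max 0 (- Re (w t))) + \<i> * of_real (max 0 (Im (w t)) - max 0 (- Im (w t)))) * gaussian t"
        unfolding w by simp
      then show "(of_real (max 0 (Re (w t))) * gaussian t - of_real (max 0 (- Re (w t))) * gaussian t)
        + \<i> * (of_real (max 0 (Im (w t))) * gaussian t - of_real (max 0 (- Im (w t))) * gaussian t) = u t"
        by (simp add: ring_distribs mult.assoc)
    qed
    finally show "u \<in> V" .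
  qed
qed (rule closed_span_subset_L2)

end

section \<open>Means and dispersions of perturbed Gaussians\<close>

text \<open>Strict convexity of \<open>\<bar>s\<bar> powr p\<close> in the form of its tangent at \<open>1\<close>. All other tangents follow by
scaling. For \<open>s \<le> 0\<close> the tangent is below zero, since \<open>p > 1\<close>.\<close>

lemma abs_powr_above_tangent:
  fixes p s :: real
  assumes p: "p > 1" and s: "s \<noteq> 1"
  shows "1 + p * (s - 1) < \<bar>s\<bar> powr p"
proof -
  consider "s > 1" | "s \<le> 0" | "0 < s" "s < 1" using s by linarith
  then show ?thesis
  proof cases
    case 1
    obtain z where z: "1 < z" "z < s" "s powr p - 1 powr p = (s - 1) * (p * z powr (p - 1))"
      using MVT2[OF 1 has_real_derivative_powr, of p] by force
    have "1 < z powr (p - 1)" using z p by (simp add: gr_one_powr)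
    then have "(s - 1) * (p * 1) < (s - 1) * (p * z powr (p - 1))"
      using 1 p by (intro mult_strict_left_mono) auto
    with z 1 show ?thesis by (simp add: algebra_simps)
  next
    case 2
    have "p * s \<le> 0" using 2 p by (intro mult_nonneg_nonpos) auto
    then have "1 + p * (s - 1) < 0" using p by (simp add: right_diff_distrib)
    then show ?thesis using powr_ge_zero[of "\<bar>s\<bar>" p] by linarith
  next
    case 3
    obtain z where z: "s < z" "z < 1" "1 powr p - s powr p = (1 - s) * (p * z powr (p - 1))"
      using MVT2[OF 3(2) has_real_derivative_powr, of p] 3(1) by force
    have "z powr (p - 1) < 1 powr (p - 1)" using z 3 p by (intro powr_less_mono2) auto
    then have "(1 - s) * (p * z powr (p - 1)) < (1 - s) * (p * 1)"
      using 3 p by (intro mult_strict_left_mono) auto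
    with z 3 show ?thesis by (simp add: algebra_simps)
  qed
qed

lemma abs_powr_strict_convex:
  fixes p x y l :: real
  assumes p: "p > 1" and xy: "x \<noteq> y" and l: "0 < l" "l < 1"
  shows "\<bar>(1 - l) * x + l * y\<bar> powr p < (1 - l) * \<bar>x\<bar> powr p + l * \<bar>y\<bar> powr p"
proof -
  \<comment> \<open>The two tangent inequalities at m are averaged; their linear terms cancel.\<close>
  define m where "m = (1 - l) * x + l * y"
  show ?thesis
  proof (cases "m = 0")
    case True
    have "0 < (1 - l) * \<bar>x\<bar> powr p + l * \<bar>y\<bar> powr p"
    proof (cases "x = 0")
      case True
      with xy l show ?thesis by simp
    next
      case False
      with l show ?thesis by (intro add_pos_nonneg) auto
    qed
    with True show ?thesis by (simp add: m_def)
  next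
    case False
    have xm: "x \<noteq> m"
    proof
      assume "x = m"
      then have "l * (y - x) = 0" unfolding m_def by (auto simp: algebra_simps)
      with l xy show False by simp
    qed
    have ym: "y \<noteq> m"
    proof
      assume "y = m"
      then have "(1 - l) * (x - y) = 0" unfolding m_def by (auto simp: algebra_simps)
      with l xy show False by simp
    qed
    have scaled: "\<bar>m\<bar> powr p * (1 + p * (z / m - 1)) < \<bar>z\<bar> powr p" if "z \<noteq> m" for z
    proof -
      have "1 + p * (z / m - 1) < \<bar>z / m\<bar> powr p"
        using that False by (intro abs_powr_above_tangent p) auto
      then have "\<bar>m\<bar> powr p * (1 + p * (z / m - 1)) < \<bar>m\<bar> powr p * \<bar>z / m\<bar> powr p"
        using False by (intro mult_strict_left_mono) auto
      also have "\<dots> = \<bar>z\<bar> powr p"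
        using False by (simp add: powr_mult[symmetric] abs_divide)
      finally show ?thesis .
    qed
    have "\<bar>m\<bar> powr p = (1 - l) * (\<bar>m\<bar> powr p * (1 + p * (x / m - 1))) + l * (\<bar>m\<bar> powr p * (1 + p * (y / m - 1)))"
    proof -
      have "(1 - l) * (\<bar>m\<bar> powr p * (1 + p * (x / m - 1))) + l * (\<bar>m\<bar> powr p * (1 + p * (y / m - 1)))
          = \<bar>m\<bar> powr p * (1 + p * (((1 - l) * x + l * y) / m - 1))"
        by (simp add: algebra_simps add_divide_distrib diff_divide_distrib)
      then show ?thesis using False unfolding m_def[symmetric] by simp
    qed
    also have "\<dots> < (1 - l) * \<bar>x\<bar> powr p + l * \<bar>y\<bar> powr p"
      using l scaled[OF xm] scaled[OF ym] by (intro add_strict_mono mult_strict_left_mono) auto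
    finally show ?thesis unfolding m_def .
  qed
qed

text \<open>A minimum on \<open>{-r..r}\<close> exists by continuity, and convexity excludes smaller values outside, since
these would force the value at \<open>r\<close> or \<open>- r\<close> below the value at \<open>0\<close>.\<close>

lemma strictly_convex_unique_min:
  fixes M :: "real \<Rightarrow> real"
  assumes sc: "\<And>x y l. x \<noteq> y \<Longrightarrow> 0 < l \<Longrightarrow> l < 1 \<Longrightarrow> M ((1 - l) * x + l * y) < (1 - l) * M x + l * M y"
    and r: "0 < r" "M 0 < M r" "M 0 < M (- r)"
  obtains a where "\<bar>a\<bar> < r" "\<And>b. b \<noteq> a \<Longrightarrow> M a < M b"
proof -
  have "convex_on UNIV M"
  proof (rule convex_onI)
    fix t x y :: real assume t: "0 < t" "t < 1"
    show "M ((1 - t) *\<^sub>R x + t *\<^sub>R y) \<le> (1 - t) * M x + t * M y"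
    proof (cases "x = y")
      case True
      then show ?thesis by (simp flip: scaleR_left_distrib distrib_right add: algebra_simps)
    next
      case False
      from sc[OF this t] show ?thesis by simp
    qed
  qed simp
  then have "continuous_on UNIV M" by (intro convex_on_continuous) auto
  then have "continuous_on {-r..r} M" by (rule continuous_on_subset) simp
  then obtain a where a: "a \<in> {-r..r}" "\<And>b. b \<in> {-r..r} \<Longrightarrow> M a \<le> M b"
    using continuous_attains_inf[of "{-r..r}" M] r by auto
  have a0: "M a \<le> M 0" using a r by auto
  have ar: "a \<noteq> r" "a \<noteq> - r" using a0 r by auto
  have far: False if b: "\<bar>b\<bar> > r" "M b \<le> M a" for b
  proof -
    \<comment> \<open>This weight places r or - r between 0 and b.\<close>
    define l where "l = r / \<bar>b\<bar>"
    have l: "0 < l" "l < 1" using b r by (auto simp: l_def)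
    have "M ((1 - l) * 0 + l * b) < (1 - l) * M 0 + l * M b"
      using b r l by (intro sc) auto
    also have "\<dots> \<le> (1 - l) * M 0 + l * M 0"
      using b a0 l by (intro add_left_mono mult_left_mono) auto
    finally have "M (l * b) < M 0" by (simp add: algebra_simps)
    moreover have "l * b = r \<or> l * b = - r" using b r by (auto simp: l_def abs_if)
    ultimately show False using r by auto
  qed
  show ?thesis
  proof (rule that[of a])
    show "\<bar>a\<bar> < r" using a ar by auto
    fix b assume b: "b \<noteq> a"
    show "M a < M b"
    proof (rule ccontr)
      assume n: "\<not> M a < M b"
      then have "b \<in> {-r..r}" using far[of b] by force
      then have "(1 - 1/2) * a + 1/2 * b \<in> {-r..r}" using a by auto
      then have "M a \<le> M ((1 - 1/2) * a + 1/2 * b)" by (rule a)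
      also have "\<dots> < (1 - 1/2) * M a + 1/2 * M b" using b by (intro sc) auto
      finally show False using n by simp
    qed
  qed
qed

text \<open>The real-valued version of \<open>centered_moment\<close>, for functions whose moments are all finite.\<close>

definition moment :: "real \<Rightarrow> (real \<Rightarrow> complex) \<Rightarrow> real \<Rightarrow> real" where
  "moment p h a = (LINT t|lborel. \<bar>t - a\<bar> powr p * (cmod (h t))\<^sup>2)"

lemma moment_nonneg: "0 \<le> moment p h a"
  by (simp add: moment_def)

context
  fixes p :: real and h :: "real \<Rightarrow> complex"
  assumes p: "p > 1"
    and int: "\<And>a. integrable lborel (\<lambda>t. \<bar>t - a\<bar> powr p * (cmod (h t))\<^sup>2)"
begin

lemma centered_moment_eq: "centered_moment p h a = ennreal (moment p h a)"
  unfolding centered_moment_def moment_def by (intro nn_integral_eq_integral int) auto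

lemma dispersion_le: "dispersion p h \<le> ennreal (sqrt (moment p h a))"
proof -
  have "dispersion p h \<le> ennreal_sqrt (centered_moment p h a)"
    unfolding dispersion_def by (intro INF_lower) auto
  then show ?thesis by (simp add: centered_moment_eq ennreal_sqrt_ennreal moment_nonneg)
qed

lemma moment_strict_convex:
  assumes h: "\<not> (AE t in lborel. h t = 0)" and l: "a \<noteq> b" "0 < l" "l < 1"
  shows "moment p h ((1 - l) * a + l * b) < (1 - l) * moment p h a + l * moment p h b"
proof -
  \<comment> \<open>The pointwise convexity gap, which is positive for every t.\<close>
  define d where "d t = ((1 - l) * \<bar>t - a\<bar> powr p + l * \<bar>t - b\<bar> powr p) - \<bar>t - ((1 - l) * a + l * b)\<bar> powr p" for t
  have d: "d t > 0" for t
  proof -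
    have "t - ((1 - l) * a + l * b) = (1 - l) * (t - a) + l * (t - b)" by (simp add: algebra_simps)
    then show ?thesis using abs_powr_strict_convex[OF p, of "t - a" "t - b" l] l by (simp add: d_def)
  qed
  have eq: "d t * (cmod (h t))\<^sup>2 = ((1 - l) * (\<bar>t - a\<bar> powr p * (cmod (h t))\<^sup>2) + l * (\<bar>t - b\<bar> powr p * (cmod (h t))\<^sup>2))
      - \<bar>t - ((1 - l) * a + l * b)\<bar> powr p * (cmod (h t))\<^sup>2" for t
    by (simp add: d_def algebra_simps)
  have i: "integrable lborel (\<lambda>t. d t * (cmod (h t))\<^sup>2)"
    unfolding eq by (intro Bochner_Integration.integrable_diff Bochner_Integration.integrable_add integrable_mult_right int)
  have "(LINT t|lborel. d t * (cmod (h t))\<^sup>2)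
      = ((1 - l) * moment p h a + l * moment p h b) - moment p h ((1 - l) * a + l * b)"
    unfolding eq moment_def using int by simp
  moreover have "0 < (LINT t|lborel. d t * (cmod (h t))\<^sup>2)"
  proof -
    have nn: "0 \<le> d t * (cmod (h t))\<^sup>2" for t using d[of t] by simp
    have "(LINT t|lborel. d t * (cmod (h t))\<^sup>2) \<noteq> 0"
    proof
      assume "(LINT t|lborel. d t * (cmod (h t))\<^sup>2) = 0"
      then have "AE t in lborel. d t * (cmod (h t))\<^sup>2 = 0"
        using integral_nonneg_eq_0_iff_AE[OF i] nn by simp
      then have "AE t in lborel. h t = 0"
        by eventually_elim (use d in \<open>auto simp: less_le\<close>)
      with h show False ..
    qed
    moreover have "0 \<le> (LINT t|lborel. d t * (cmod (h t))\<^sup>2)" using nn by simp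
    ultimately show ?thesis by linarith
  qed
  ultimately show ?thesis by linarith
qed

text \<open>The mean is located by comparing only three values of the moment, which makes the statement stable
under small perturbations of \<open>h\<close>.\<close>

lemma p_mean_near_zero:
  assumes r: "0 < r" "moment p h 0 < moment p h r" "moment p h 0 < moment p h (- r)"
  shows "\<bar>p_mean p h\<bar> < r"
proof -
  have nz: "\<not> (AE t in lborel. h t = 0)"
  proof
    assume "AE t in lborel. h t = 0"
    then have "AE t in lborel. \<bar>t - r\<bar> powr p * (cmod (h t))\<^sup>2 = 0" by eventually_elim simp
    then have "moment p h r = 0" unfolding moment_def by (rule integral_eq_zero_AE)
    with r(2) moment_nonneg[of p h 0] show False by simp
  qed
  obtain a where a: "\<bar>a\<bar> < r" "\<And>b. b \<noteq> a \<Longrightarrow> moment p h a < moment p h b"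
    using strictly_convex_unique_min[OF moment_strict_convex[OF nz] r] by blast
  have le: "ennreal_sqrt (centered_moment p h b) < ennreal_sqrt (centered_moment p h c) \<longleftrightarrow> moment p h b < moment p h c" for b c
    by (simp add: centered_moment_eq ennreal_sqrt_ennreal moment_nonneg ennreal_less_iff)
  have "p_mean p h = a"
    unfolding p_mean_def
  proof (rule the_equality)
    show "is_arg_min (\<lambda>a. ennreal_sqrt (centered_moment p h a)) (\<lambda>_. True) a"
      unfolding is_arg_min_def le using a(2) by (metis less_asym)
  next
    fix b assume "is_arg_min (\<lambda>a. ennreal_sqrt (centered_moment p h a)) (\<lambda>_. True) b"
    then show "b = a" unfolding is_arg_min_def le using a(2) by blast
  qed
  with a show ?thesis by simp
qed

end

lemma centered_moment_cong_AE:
  assumes "AE t in lborel. u t = v t"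
  shows "centered_moment p u = centered_moment p v"
  unfolding centered_moment_def
  by (intro ext nn_integral_cong_AE) (use assms in eventually_elim, simp)

lemma dispersion_cong_AE: "AE t in lborel. u t = v t \<Longrightarrow> dispersion p u = dispersion p v"
  by (simp add: dispersion_def centered_moment_cong_AE)

lemma p_mean_cong_AE: "AE t in lborel. u t = v t \<Longrightarrow> p_mean p u = p_mean p v"
  by (simp add: p_mean_def centered_moment_cong_AE)

lemma integrable_moment:
  "p \<ge> 0 \<Longrightarrow> exp_growth \<phi> \<Longrightarrow> integrable lborel (\<lambda>t. \<bar>t - a\<bar> powr p * (cmod (\<phi> t * gaussian t))\<^sup>2)"
  by (intro integrable_weighted_gaussian exp_growth_powr)

lemma integrable_moment_gaussian:
  "p \<ge> 0 \<Longrightarrow> integrable lborel (\<lambda>t. \<bar>t - a\<bar> powr p * (cmod (gaussian t))\<^sup>2)"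
  using integrable_moment[OF _ exp_growth_const[of 1]] by simp

text \<open>The moment is even in \<open>a\<close>, and \<open>0\<close> is the midpoint of \<open>a\<close> and \<open>- a\<close>.\<close>

lemma moment_gaussian_min:
  assumes p: "p > 1" and a: "a \<noteq> 0"
  shows "moment p gaussian 0 < moment p gaussian a"
proof -
  have "moment p gaussian (- a) = (LINT t|lborel. \<bar>0 + (- 1) * t - (- a)\<bar> powr p * (cmod (gaussian (0 + (- 1) * t)))\<^sup>2)"
    unfolding moment_def by (subst lborel_integral_real_affine[of "-1" _ 0]) auto
  also have "\<dots> = moment p gaussian a"
    unfolding moment_def by (intro Bochner_Integration.integral_cong) (auto simp: gaussian_def abs_minus_commute)
  finally have sym: "moment p gaussian (- a) = moment p gaussian a" .
  have "\<not> (AE t in lborel. gaussian t = 0)"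
    by (simp add: gaussian_nonzero AE_iff_measurable[OF _ refl])
  from moment_strict_convex[OF p _ this, of a "- a" "1/2"] a p
  show ?thesis by (simp add: sym integrable_moment_gaussian)
qed

lemma dispersion_gaussian:
  assumes p: "p > 1"
  shows "dispersion p gaussian = ennreal (sqrt (moment p gaussian 0))"
proof (rule antisym)
  show "dispersion p gaussian \<le> ennreal (sqrt (moment p gaussian 0))"
    using p by (intro dispersion_le integrable_moment_gaussian) auto
  show "ennreal (sqrt (moment p gaussian 0)) \<le> dispersion p gaussian"
    unfolding dispersion_def
  proof (rule INF_greatest)
    fix a
    have "moment p gaussian 0 \<le> moment p gaussian a"
      using moment_gaussian_min[OF p, of a] by (cases "a = 0") auto
    then show "ennreal (sqrt (moment p gaussian 0)) \<le> ennreal_sqrt (centered_moment p gaussian a)"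
      using p by (simp add: centered_moment_eq integrable_moment_gaussian ennreal_sqrt_ennreal moment_nonneg ennreal_leI)
  qed
qed

lemma integral_gaussian_sq: "(LINT t|lborel. (cmod (gaussian t))\<^sup>2) = 1"
proof -
  \<comment> \<open>With this deviation the normal density equals the square of the Gaussian.\<close>
  define \<sigma> where "\<sigma> = sqrt (1 / (4 * pi))"
  have \<sigma>: "\<sigma> > 0" "\<sigma>\<^sup>2 = 1 / (4 * pi)" by (auto simp: \<sigma>_def)
  have "normal_density 0 \<sigma> t = (cmod (gaussian t))\<^sup>2" for t
    unfolding normal_density_def \<sigma>(2) cmod_gaussian_sq
    by (simp add: real_sqrt_divide)
  then have "(LINT t|lborel. (cmod (gaussian t))\<^sup>2) = (LINT t|lborel. normal_density 0 \<sigma> t)"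
    by simp
  then show ?thesis using \<sigma> by simp
qed

text \<open>Expanding the square shows that the integral is a quadratic polynomial in \<open>e\<close>.\<close>

lemma weighted_integral_perturbed_gaussian:
  assumes \<omega>: "exp_growth (\<omega> :: real \<Rightarrow> real)" and \<phi>: "exp_growth \<phi>"
  shows "((\<lambda>e. LINT t|lborel. \<omega> t * (cmod ((1 + of_real e * \<phi> t) * gaussian t))\<^sup>2)
      \<longlongrightarrow> (LINT t|lborel. \<omega> t * (cmod (gaussian t))\<^sup>2)) (at_right 0)"
proof -
  have [measurable]: "\<phi> \<in> borel_measurable borel" using \<phi> by (rule exp_growth_borel)
  have Re: "exp_growth (\<lambda>t. Re (\<phi> t))"
    by (rule exp_growth_mono[OF \<phi>]) (auto simp: abs_Re_le_cmod)
  have "integrable lborel (\<lambda>t. (\<omega> t * Re (\<phi> t)) * (cmod (1 * gaussian t))\<^sup>2)"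
    by (intro integrable_weighted_gaussian exp_growth_mult \<omega> Re exp_growth_const)
  then have iB: "integrable lborel (\<lambda>t. \<omega> t * Re (\<phi> t) * (cmod (gaussian t))\<^sup>2)" by simp
  have iA: "integrable lborel (\<lambda>t. \<omega> t * (cmod (gaussian t))\<^sup>2)"
    using integrable_weighted_gaussian[OF \<omega> exp_growth_const[of 1]] by simp
  have iC: "integrable lborel (\<lambda>t. \<omega> t * (cmod (\<phi> t * gaussian t))\<^sup>2)"
    by (intro integrable_weighted_gaussian \<omega> \<phi>)
  define A B C where "A = (LINT t|lborel. \<omega> t * (cmod (gaussian t))\<^sup>2)"
    and "B = (LINT t|lborel. \<omega> t * Re (\<phi> t) * (cmod (gaussian t))\<^sup>2)"
    and "C = (LINT t|lborel. \<omega> t * (cmod (\<phi> t * gaussian t))\<^sup>2)"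
  have "(LINT t|lborel. \<omega> t * (cmod ((1 + of_real e * \<phi> t) * gaussian t))\<^sup>2) = A + 2 * e * B + e\<^sup>2 * C" for e
  proof -
    have "\<omega> t * (cmod ((1 + of_real e * \<phi> t) * gaussian t))\<^sup>2
        = \<omega> t * (cmod (gaussian t))\<^sup>2 + (2 * e) * (\<omega> t * Re (\<phi> t) * (cmod (gaussian t))\<^sup>2)
          + e\<^sup>2 * (\<omega> t * (cmod (\<phi> t * gaussian t))\<^sup>2)" for t
    proof -
      have "(cmod (1 + of_real e * \<phi> t))\<^sup>2 = 1 + 2 * e * Re (\<phi> t) + e\<^sup>2 * (cmod (\<phi> t))\<^sup>2"
        unfolding cmod_power2 by (simp add: power2_eq_square algebra_simps)
      then show ?thesis unfolding norm_mult power_mult_distrib by (simp add: algebra_simps)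
    qed
    then show ?thesis unfolding A_def B_def C_def using iA iB iC by simp
  qed
  moreover have "((\<lambda>e. A + 2 * e * B + e\<^sup>2 * C) \<longlongrightarrow> A + 2 * 0 * B + 0\<^sup>2 * C) (at_right 0)"
    by (intro tendsto_intros)
  ultimately show ?thesis by (simp add: A_def)
qed

text \<open>The normalizing constant is a separate argument because a function and its Fourier
transform are to share it.\<close>

definition perturbed_gaussian :: "real \<Rightarrow> real \<Rightarrow> (real \<Rightarrow> complex) \<Rightarrow> real \<Rightarrow> complex" where
  "perturbed_gaussian c e \<phi> t = of_real c * ((1 + of_real e * \<phi> t) * gaussian t)"

definition localized :: "real \<Rightarrow> real \<Rightarrow> (real \<Rightarrow> complex) \<Rightarrow> bool" where
  "localized p \<epsilon> h \<longleftrightarrow> dispersion p h < \<infinity> \<and> \<bar>p_mean p h\<bar> < \<epsilon> \<and>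
     dispersion p h < dispersion p gaussian + ennreal \<epsilon>"

text \<open>The moments at \<open>0\<close>, \<open>r\<close> and \<open>- r\<close> converge to those of the Gaussian, so the strict inequalities
which hold for the Gaussian persist for small \<open>e\<close>.\<close>

lemma perturbed_gaussian_localized:
  assumes p: "p > 1" and \<phi>: "exp_growth \<phi>" and \<epsilon>: "\<epsilon> > 0"
    and c: "(c \<longlongrightarrow> 1) (at_right 0)"
  shows "\<forall>\<^sub>F e in at_right (0::real). localized p \<epsilon> (perturbed_gaussian (c e) e \<phi>)"
proof -
  let ?h = "\<lambda>e. perturbed_gaussian (c e) e \<phi>"
  have int: "integrable lborel (\<lambda>t. \<bar>t - a\<bar> powr p * (cmod (?h e t))\<^sup>2)" for a e
    using p integrable_moment[of p "\<lambda>t. of_real (c e) * (1 + of_real e * \<phi> t)" a]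
    by (simp add: perturbed_gaussian_def mult.assoc exp_growth_mult exp_growth_add exp_growth_const \<phi>)
  have lim: "((\<lambda>e. moment p (?h e) a) \<longlongrightarrow> moment p gaussian a) (at_right 0)" for a
  proof -
    have "((\<lambda>e. (c e)\<^sup>2 * (LINT t|lborel. \<bar>t - a\<bar> powr p * (cmod ((1 + of_real e * \<phi> t) * gaussian t))\<^sup>2))
        \<longlongrightarrow> 1\<^sup>2 * moment p gaussian a) (at_right 0)"
      unfolding moment_def using p by (intro tendsto_intros c weighted_integral_perturbed_gaussian \<phi> exp_growth_powr) auto
    moreover have "moment p (?h e) a = (c e)\<^sup>2 * (LINT t|lborel. \<bar>t - a\<bar> powr p * (cmod ((1 + of_real e * \<phi> t) * gaussian t))\<^sup>2)" for e
    proof -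
      have "\<bar>t - a\<bar> powr p * (cmod (?h e t))\<^sup>2
          = (c e)\<^sup>2 * (\<bar>t - a\<bar> powr p * (cmod ((1 + of_real e * \<phi> t) * gaussian t))\<^sup>2)" for t
        by (simp add: perturbed_gaussian_def norm_mult power_mult_distrib)
      then show ?thesis unfolding moment_def by (simp only: integral_mult_right_zero)
    qed
    ultimately show ?thesis by simp
  qed
  \<comment> \<open>Any radius strictly between 0 and the required bound would do.\<close>
  define r where "r = \<epsilon> / 2"
  have r: "0 < r" "r < \<epsilon>" using \<epsilon> by (auto simp: r_def)
  have gap: "\<forall>\<^sub>F e in at_right 0. 0 < moment p (?h e) a - moment p (?h e) 0" if "a \<noteq> 0" for a
    using moment_gaussian_min[OF p that] by (intro order_tendstoD(1)[OF tendsto_diff[OF lim lim]]) simp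
  have disp: "\<forall>\<^sub>F e in at_right 0. sqrt (moment p (?h e) 0) < sqrt (moment p gaussian 0) + \<epsilon>"
    using \<epsilon> by (intro order_tendstoD(2)[OF tendsto_real_sqrt[OF lim]]) simp
  have "r \<noteq> 0" "- r \<noteq> 0" using r by auto
  from gap[OF this(1)] gap[OF this(2)] disp show ?thesis
  proof eventually_elim
    case (elim e)
    have mean: "\<bar>p_mean p (?h e)\<bar> < \<epsilon>"
      using p_mean_near_zero[OF p int r(1)] elim r by fastforce
    have le: "dispersion p (?h e) \<le> ennreal (sqrt (moment p (?h e) 0))"
      by (rule dispersion_le[OF p int])
    have "ennreal (sqrt (moment p (?h e) 0)) < ennreal (sqrt (moment p gaussian 0) + \<epsilon>)"
      using elim(3) \<epsilon> by (intro ennreal_lessI add_nonneg_pos) (auto simp: moment_nonneg)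
    also have "\<dots> = dispersion p gaussian + ennreal \<epsilon>"
      using \<epsilon> by (simp add: dispersion_gaussian[OF p] ennreal_plus moment_nonneg)
    finally have "dispersion p (?h e) < dispersion p gaussian + ennreal \<epsilon>"
      using le by (rule le_less_trans[rotated])
    moreover have "dispersion p (?h e) < \<infinity>" using le by (simp add: le_less_trans)
    ultimately show ?case using mean by (simp add: localized_def)
  qed
qed

section \<open>The perturbed system\<close>

lemma perturbed_gaussian_poly:
  "perturbed_gaussian c e (\<lambda>t. poly P (of_real t))
     = (\<lambda>t. poly (smult (of_real c) (1 + smult (of_real e) P)) (of_real t) * gaussian t)"
  by (auto simp: perturbed_gaussian_def fun_eq_iff mult.assoc)

text \<open>The Gaussian is its own transform, so a perturbed Gaussian is mapped to a perturbed Gaussian with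
the same constants.\<close>

lemma is_fourier_transform_perturbed_gaussian:
  assumes Q: "\<And>\<xi>. gauss_integral pi (- 2 * pi * \<xi>) P = poly Q (of_real \<xi>) * of_real (exp (- pi * \<xi>\<^sup>2))"
  shows "is_fourier_transform (perturbed_gaussian c e (\<lambda>t. poly P (of_real t)))
      (perturbed_gaussian c e (\<lambda>\<xi>. poly Q (of_real \<xi>)))"
  unfolding perturbed_gaussian_poly
proof (rule is_fourier_transform_poly_gaussian)
  fix \<xi> :: real
  show "gauss_integral pi (- 2 * pi * \<xi>) (smult (of_real c) (1 + smult (of_real e) P))
      = poly (smult (of_real c) (1 + smult (of_real e) Q)) (of_real \<xi>) * of_real (exp (- pi * \<xi>\<^sup>2))"
    unfolding gauss_integral_smult gauss_integral_add[OF pi_gt_zero] gauss_integral_one Q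
    by (simp add: algebra_simps)
qed

lemma fourier_gaussian_AE: "AE \<xi> in lborel. fourier gaussian \<xi> = gaussian \<xi>"
proof (rule fourier_AE_eq(2))
  show "is_fourier_transform gaussian gaussian"
    using is_fourier_transform_poly_gaussian[of 1 1] gauss_integral_one by simp
qed simp

lemma borel_perturbed_gaussian [measurable]:
  assumes [measurable]: "\<phi> \<in> borel_measurable borel"
  shows "perturbed_gaussian c e \<phi> \<in> borel_measurable borel"
  unfolding perturbed_gaussian_def[abs_def] by measurable

text \<open>The conditions in time and in frequency all hold for every sufficiently small \<open>e\<close>, hence they can be
met simultaneously. The bound \<open>\<eta>\<close> will be chosen summable over the system.\<close>

lemma exists_small_perturbation:
  fixes P Q :: "complex poly" and p q \<epsilon> \<eta> :: real
  assumes p: "p > 1" and q: "q > 1" and \<epsilon>: "\<epsilon> > 0" and \<eta>: "\<eta> > 0"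
  defines "\<phi> \<equiv> \<lambda>t. poly P (complex_of_real t)" and "\<psi> \<equiv> \<lambda>t. poly Q (complex_of_real t)"
  shows "\<exists>e c. 0 < e \<and> 0 < c \<and> c \<le> 2 \<and> L2_norm (perturbed_gaussian c e \<phi>) = 1
    \<and> localized p \<epsilon> (perturbed_gaussian c e \<phi>) \<and> localized q \<epsilon> (perturbed_gaussian c e \<psi>)
    \<and> e\<^sup>2 * (LINT t|lborel. (cmod (\<phi> t * gaussian t))\<^sup>2) \<le> \<eta>
    \<and> e\<^sup>2 * (LINT t|lborel. (cmod (\<psi> t * gaussian t))\<^sup>2) \<le> \<eta>"
proof -
  have eg: "exp_growth \<phi>" "exp_growth \<psi>" unfolding \<phi>_def \<psi>_def by (rule exp_growth_poly)+
  define N where "N e = (LINT t|lborel. (cmod ((1 + of_real e * \<phi> t) * gaussian t))\<^sup>2)" for e :: real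
  define c where "c e = 1 / sqrt (N e)" for e
  have N: "(N \<longlongrightarrow> 1) (at_right 0)"
    using weighted_integral_perturbed_gaussian[OF exp_growth_const[of 1] eg(1)]
    unfolding N_def[abs_def] by (simp add: integral_gaussian_sq)
  have c: "(c \<longlongrightarrow> 1) (at_right 0)"
    unfolding c_def[abs_def] by (rule tendsto_eq_intros N | simp)+
  have sq: "\<forall>\<^sub>F e in at_right 0. e\<^sup>2 * C \<le> \<eta>" for C :: real
  proof -
    have "((\<lambda>e. e\<^sup>2 * C) \<longlongrightarrow> 0\<^sup>2 * C) (at_right 0)" by (intro tendsto_intros)
    then have "\<forall>\<^sub>F e in at_right 0. e\<^sup>2 * C < \<eta>" using \<eta> by (intro order_tendstoD(2)[of _ 0]) auto
    then show ?thesis by eventually_elim simp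
  qed
  have "\<forall>\<^sub>F e in at_right 0. 0 < N e" "\<forall>\<^sub>F e in at_right 0. c e < 2" "\<forall>\<^sub>F e in at_right (0::real). 0 < e"
    by (auto intro: order_tendstoD(1)[OF N] order_tendstoD(2)[OF c] eventually_at_right_less)
  moreover note perturbed_gaussian_localized[OF p eg(1) \<epsilon> c] perturbed_gaussian_localized[OF q eg(2) \<epsilon> c]
    sq[of "LINT t|lborel. (cmod (\<phi> t * gaussian t))\<^sup>2"] sq[of "LINT t|lborel. (cmod (\<psi> t * gaussian t))\<^sup>2"]
  ultimately have "\<forall>\<^sub>F e in at_right 0. 0 < N e \<and> c e < 2 \<and> 0 < e
      \<and> localized p \<epsilon> (perturbed_gaussian (c e) e \<phi>) \<and> localized q \<epsilon> (perturbed_gaussian (c e) e \<psi>)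
      \<and> e\<^sup>2 * (LINT t|lborel. (cmod (\<phi> t * gaussian t))\<^sup>2) \<le> \<eta>
      \<and> e\<^sup>2 * (LINT t|lborel. (cmod (\<psi> t * gaussian t))\<^sup>2) \<le> \<eta>"
    by eventually_elim auto
  then obtain e where e: "0 < N e" "c e < 2" "0 < e"
      "localized p \<epsilon> (perturbed_gaussian (c e) e \<phi>)" "localized q \<epsilon> (perturbed_gaussian (c e) e \<psi>)"
      "e\<^sup>2 * (LINT t|lborel. (cmod (\<phi> t * gaussian t))\<^sup>2) \<le> \<eta>"
      "e\<^sup>2 * (LINT t|lborel. (cmod (\<psi> t * gaussian t))\<^sup>2) \<le> \<eta>"
    using eventually_happens'[OF trivial_limit_at_right_real] by blast
  have "L2_norm (perturbed_gaussian (c e) e \<phi>) = 1"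
  proof -
    have eq: "(cmod (perturbed_gaussian (c e) e \<phi> t))\<^sup>2 = (c e)\<^sup>2 * (cmod ((1 + of_real e * \<phi> t) * gaussian t))\<^sup>2" for t
      by (simp add: perturbed_gaussian_def norm_mult power_mult_distrib)
    have "integrable lborel (\<lambda>t. (cmod ((1 + of_real e * \<phi> t) * gaussian t))\<^sup>2)"
      by (intro integrable_energy_gaussian exp_growth_add exp_growth_mult exp_growth_const eg)
    then have "integrable lborel (\<lambda>t. (cmod (perturbed_gaussian (c e) e \<phi> t))\<^sup>2)" unfolding eq by simp
    then have "L2_norm (perturbed_gaussian (c e) e \<phi>) = ennreal (sqrt ((c e)\<^sup>2 * N e))"
      by (subst L2_norm_eq_integral) (simp_all add: eq N_def)
    also have "(c e)\<^sup>2 * N e = 1" using e(1) by (simp add: c_def power_divide)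
    finally show ?thesis by simp
  qed
  moreover have "0 < c e" using e(1) by (simp add: c_def)
  ultimately show ?thesis using e by (intro exI[of _ e] exI[of _ "c e"]) auto
qed

lemma ennreal_sqrt_sq: "(ennreal_sqrt x)\<^sup>2 = x"
  by (cases x) (auto simp: ennreal_sqrt_def ennreal_power)

lemma ennreal_sqrt_of_sq: "0 \<le> r \<Longrightarrow> ennreal_sqrt (ennreal (r\<^sup>2)) = ennreal r"
  by (simp add: ennreal_sqrt_ennreal)

lemma term_le_suminf: "x n \<le> (\<Sum>k. x k)" for x :: "nat \<Rightarrow> ennreal"
  using sum_le_suminf[OF summableI, of "{n}" x] by simp

text \<open>The square of each \<open>\<bar>u n\<bar>\<close> is at most \<open>8 * \<bar>gaussian\<bar>\<^sup>2\<close> plus \<open>8\<close> times the square of its own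
perturbation; summing the latter over \<open>n\<close> gives an integrable bound for the supremum. Equality is
required only almost everywhere because \<open>fourier\<close> picks an unknown representative for each \<open>n\<close>.\<close>

lemma envelope_nonneg_L2:
  fixes u :: "nat \<Rightarrow> real \<Rightarrow> complex"
  assumes \<phi>: "\<And>n. exp_growth (\<phi> n)"
    and c: "\<And>n. 0 \<le> c n" "\<And>n. c n \<le> 2"
    and e: "\<And>n. (e n)\<^sup>2 * (LINT t|lborel. (cmod (\<phi> n t * gaussian t))\<^sup>2) \<le> (1/2) ^ n"
    and u[measurable]: "\<And>n. u n \<in> borel_measurable borel"
    and eq: "\<And>n. AE t in lborel. u n t = perturbed_gaussian (c n) (e n) (\<phi> n) t"
  shows "(\<lambda>t. SUP n. ennreal (cmod (u n t))) \<in> nonneg_L2"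
proof -
  have [measurable]: "\<phi> n \<in> borel_measurable borel" for n by (rule exp_growth_borel[OF \<phi>])
  define B where "B t = ennreal (8 * (cmod (gaussian t))\<^sup>2) + (\<Sum>n. ennreal (8 * ((e n)\<^sup>2 * (cmod (\<phi> n t * gaussian t))\<^sup>2)))" for t
  have [measurable]: "B \<in> borel_measurable borel" unfolding B_def[abs_def] by measurable
  have le: "ennreal (cmod (perturbed_gaussian (c n) (e n) (\<phi> n) t)) \<le> ennreal_sqrt (B t)" for n t
  proof -
    have "(cmod (perturbed_gaussian (c n) (e n) (\<phi> n) t))\<^sup>2
        = (c n)\<^sup>2 * (cmod (gaussian t + of_real (e n) * (\<phi> n t * gaussian t)))\<^sup>2"
    proof -
      have "perturbed_gaussian (c n) (e n) (\<phi> n) t = of_real (c n) * (gaussian t + of_real (e n) * (\<phi> n t * gaussian t))"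
        by (simp add: perturbed_gaussian_def ring_distribs mult.assoc)
      then show ?thesis by (simp only: norm_mult power_mult_distrib norm_of_real power2_abs)
    qed
    also have "\<dots> \<le> 2\<^sup>2 * (2 * (cmod (gaussian t))\<^sup>2 + 2 * (cmod (of_real (e n) * (\<phi> n t * gaussian t)))\<^sup>2)"
      by (intro mult_mono power_mono c cmod_add_sq_le) auto
    also have "\<dots> = 8 * (cmod (gaussian t))\<^sup>2 + 8 * ((e n)\<^sup>2 * (cmod (\<phi> n t * gaussian t))\<^sup>2)"
      unfolding norm_mult[of "of_real (e n)"] power_mult_distrib[of "cmod (of_real (e n))"] by simp
    finally have "ennreal ((cmod (perturbed_gaussian (c n) (e n) (\<phi> n) t))\<^sup>2)
        \<le> ennreal (8 * (cmod (gaussian t))\<^sup>2 + 8 * ((e n)\<^sup>2 * (cmod (\<phi> n t * gaussian t))\<^sup>2))"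
      by (rule ennreal_leI)
    also have "\<dots> = ennreal (8 * (cmod (gaussian t))\<^sup>2) + ennreal (8 * ((e n)\<^sup>2 * (cmod (\<phi> n t * gaussian t))\<^sup>2))"
      by (intro ennreal_plus) auto
    also have "\<dots> \<le> B t"
      unfolding B_def by (intro add_left_mono term_le_suminf)
    finally have "ennreal_sqrt (ennreal ((cmod (perturbed_gaussian (c n) (e n) (\<phi> n) t))\<^sup>2)) \<le> ennreal_sqrt (B t)"
      by (simp only: ennreal_sqrt_le_iff)
    then show ?thesis by (simp only: ennreal_sqrt_of_sq norm_ge_zero)
  qed
  have "AE t in lborel. \<forall>n. u n t = perturbed_gaussian (c n) (e n) (\<phi> n) t"
    unfolding AE_all_countable using eq by blast
  then have bound: "AE t in lborel. (SUP n. ennreal (cmod (u n t)))\<^sup>2 \<le> B t"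
  proof eventually_elim
    case (elim t)
    have "(SUP n. ennreal (cmod (u n t))) \<le> ennreal_sqrt (B t)"
      by (intro SUP_least) (simp add: elim le)
    then have "(SUP n. ennreal (cmod (u n t)))\<^sup>2 \<le> (ennreal_sqrt (B t))\<^sup>2"
      by (intro power_mono) auto
    then show ?case by (simp add: ennreal_sqrt_sq)
  qed
  have "(\<integral>\<^sup>+ t. (SUP n. ennreal (cmod (u n t)))\<^sup>2 \<partial>lborel) \<le> (\<integral>\<^sup>+ t. B t \<partial>lborel)"
    by (intro nn_integral_mono_AE bound)
  also have "\<dots> = (\<integral>\<^sup>+ t. ennreal (8 * (cmod (gaussian t))\<^sup>2) \<partial>lborel)
      + (\<Sum>n. \<integral>\<^sup>+ t. ennreal (8 * ((e n)\<^sup>2 * (cmod (\<phi> n t * gaussian t))\<^sup>2)) \<partial>lborel)"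
    unfolding B_def by (simp add: nn_integral_add nn_integral_suminf)
  also have "\<dots> \<le> ennreal 8 + (\<Sum>n. ennreal (8 * (1/2) ^ n))"
  proof (intro add_mono suminf_le)
    have "integrable lborel (\<lambda>t. (cmod (gaussian t))\<^sup>2)"
      using integrable_energy_gaussian[OF exp_growth_const[of 1]] by simp
    then show "(\<integral>\<^sup>+ t. ennreal (8 * (cmod (gaussian t))\<^sup>2) \<partial>lborel) \<le> ennreal 8"
      by (subst nn_integral_eq_integral) (auto simp: integral_gaussian_sq)
    fix n
    have "integrable lborel (\<lambda>t. 8 * ((e n)\<^sup>2 * (cmod (\<phi> n t * gaussian t))\<^sup>2))"
      by (intro integrable_mult_right integrable_energy_gaussian \<phi>)
    then have "(\<integral>\<^sup>+ t. ennreal (8 * ((e n)\<^sup>2 * (cmod (\<phi> n t * gaussian t))\<^sup>2)) \<partial>lborel)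
        = ennreal (LINT t|lborel. 8 * ((e n)\<^sup>2 * (cmod (\<phi> n t * gaussian t))\<^sup>2))"
      by (intro nn_integral_eq_integral) auto
    also have "\<dots> = ennreal (8 * ((e n)\<^sup>2 * (LINT t|lborel. (cmod (\<phi> n t * gaussian t))\<^sup>2)))"
      by (simp only: integral_mult_right_zero)
    also have "\<dots> \<le> ennreal (8 * (1/2) ^ n)"
      using e[of n] by (intro ennreal_leI) simp
    finally show "(\<integral>\<^sup>+ t. ennreal (8 * ((e n)\<^sup>2 * (cmod (\<phi> n t * gaussian t))\<^sup>2)) \<partial>lborel) \<le> ennreal (8 * (1/2) ^ n)" .
  qed auto
  also have "(\<Sum>n. ennreal (8 * (1/2) ^ n)) = ennreal (\<Sum>n. 8 * (1/2) ^ n)"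
    by (intro suminf_ennreal2 summable_mult summable_geometric) auto
  also have "ennreal 8 + ennreal (\<Sum>n. 8 * (1/2) ^ n) < \<infinity>" by simp
  finally show ?thesis by (simp add: nonneg_L2_def)
qed

section \<open>Exactness\<close>

lemma integrable_L2_mult:
  assumes "u \<in> L2" "k \<in> L2"
  shows "integrable lborel (\<lambda>t. u t * k t)"
proof -
  note [measurable] = mem_L2_borel[OF assms(1)] mem_L2_borel[OF assms(2)]
  have "(\<integral>\<^sup>+ t. ennreal (cmod (u t)) * ennreal (cmod (k t)) \<partial>lborel)\<^sup>2 \<le> energy u * energy k"
    unfolding energy_def using Cauchy_Schwarz_nn_integral[of "\<lambda>t. ennreal (cmod (u t))" lborel "\<lambda>t. ennreal (cmod (k t))"]
    by (simp add: ennreal_power)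
  also have "\<dots> < \<infinity>" using assms by (simp add: mem_L2_iff ennreal_mult_less_top)
  finally have "(\<integral>\<^sup>+ t. ennreal (cmod (u t)) * ennreal (cmod (k t)) \<partial>lborel) < \<infinity>"
    by (simp add: power_less_top_ennreal)
  then show ?thesis by (simp add: integrable_iff_bounded norm_mult ennreal_mult)
qed

lemma Cauchy_Schwarz_energy:
  assumes "u \<in> L2" "k \<in> L2"
  shows "ennreal ((cmod (LINT t|lborel. u t * k t))\<^sup>2) \<le> energy u * energy k"
proof -
  note [measurable] = mem_L2_borel[OF assms(1)] mem_L2_borel[OF assms(2)]
  have "ennreal (cmod (LINT t|lborel. u t * k t)) \<le> (\<integral>\<^sup>+ t. ennreal (cmod (u t * k t)) \<partial>lborel)"
    by (rule integral_norm_bound_ennreal[OF integrable_L2_mult[OF assms]])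
  then have "(ennreal (cmod (LINT t|lborel. u t * k t)))\<^sup>2 \<le> (\<integral>\<^sup>+ t. ennreal (cmod (u t)) * ennreal (cmod (k t)) \<partial>lborel)\<^sup>2"
    by (intro power_mono) (auto simp: norm_mult ennreal_mult)
  also have "\<dots> \<le> energy u * energy k"
    unfolding energy_def using Cauchy_Schwarz_nn_integral[of "\<lambda>t. ennreal (cmod (u t))" lborel "\<lambda>t. ennreal (cmod (k t))"]
    by (simp add: ennreal_power)
  finally show ?thesis by (simp add: ennreal_power)
qed

text \<open>By the Cauchy-Schwarz inequality, pairing with \<open>k\<close> is continuous on \<open>L2\<close>. The pairing is bilinear,
without conjugation; this suffices to separate a function from a closed span.\<close>

lemma annihilator_closed_span:
  assumes S: "S \<subseteq> L2" and k: "k \<in> L2" and ann: "\<And>u. u \<in> S \<Longrightarrow> (LINT t|lborel. u t * k t) = 0"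
    and h: "h \<in> L2_closed_span S"
  shows "(LINT t|lborel. h t * k t) = 0"
proof -
  have hL: "h \<in> L2" using h closed_span_subset_L2 by blast
  have "cfun.span S \<subseteq> {u \<in> L2. (LINT t|lborel. u t * k t) = 0}"
  proof (rule cfun.span_minimal)
    show "S \<subseteq> {u \<in> L2. (LINT t|lborel. u t * k t) = 0}" using S ann by auto
    show "cfun.subspace {u \<in> L2. (LINT t|lborel. u t * k t) = 0}"
      unfolding cfun.subspace_def
      by (auto simp: L2_zero L2_add L2_scale[unfolded fun_scale_def] ring_distribs integrable_L2_mult k fun_scale_def mult.assoc)
  qed
  then have span: "u \<in> L2" "(LINT t|lborel. u t * k t) = 0" if "u \<in> cfun.span S" for u using that by auto
  have small: "(cmod (LINT t|lborel. h t * k t))\<^sup>2 \<le> d" if d: "d > 0" for d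
  proof -
    \<comment> \<open>Adding 1 keeps the divisor positive when k vanishes.\<close>
    define b where "b = enn2real (energy k) + 1"
    have b: "b > 0" by (simp add: b_def add_nonneg_pos)
    have kb: "energy k \<le> ennreal b"
      using k by (cases "energy k") (auto simp: b_def mem_L2_iff ennreal_plus intro: ennreal_leI)
    obtain u where u: "u \<in> cfun.span S" "energy (h - u) < ennreal (d / b)"
      using h d b unfolding mem_closed_span_iff by (meson divide_pos_pos)
    have "(LINT t|lborel. (h - u) t * k t) = (LINT t|lborel. h t * k t) - (LINT t|lborel. u t * k t)"
      using integrable_L2_mult[OF hL k] integrable_L2_mult[OF span(1)[OF u(1)] k]
      by (simp add: left_diff_distrib)
    then have "ennreal ((cmod (LINT t|lborel. h t * k t))\<^sup>2) \<le> energy (h - u) * energy k"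
      using Cauchy_Schwarz_energy[OF L2_diff[OF hL span(1)[OF u(1)]] k] span(2)[OF u(1)] by simp
    also have "\<dots> \<le> ennreal (d / b) * ennreal b"
      using u kb by (intro mult_mono) auto
    also have "\<dots> = ennreal d" using b d by (simp add: ennreal_mult[symmetric])
    finally show ?thesis using d by simp
  qed
  have "(cmod (LINT t|lborel. h t * k t))\<^sup>2 \<le> 0"
    by (rule field_le_epsilon) (use small in simp)
  then show ?thesis by simp
qed

lemma integral_gaussian_product:
  "(LINT t|lborel. (poly P (of_real t) * gaussian t) * (poly Q (of_real t) * gaussian t))
    = of_real (sqrt 2) * gauss_integral (2 * pi) 0 (P * Q)"
proof -
  have g: "gaussian t * gaussian t = of_real (sqrt 2) * gauss_wave (2 * pi) 0 t" for t
  proof -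
    have "gaussian t * gaussian t = of_real ((cmod (gaussian t))\<^sup>2)"
      by (simp add: gaussian_def power2_eq_square norm_mult)
    then show ?thesis unfolding cmod_gaussian_sq by (simp add: gauss_wave_def)
  qed
  have "(poly P (of_real t) * gaussian t) * (poly Q (of_real t) * gaussian t)
      = of_real (sqrt 2) * (poly (P * Q) (of_real t) * gauss_wave (2 * pi) 0 t)" for t
  proof -
    have "(poly P (of_real t) * gaussian t) * (poly Q (of_real t) * gaussian t)
        = poly P (of_real t) * poly Q (of_real t) * (gaussian t * gaussian t)" by (simp only: mult_ac)
    then show ?thesis unfolding g by (simp only: poly_mult mult_ac)
  qed
  then show ?thesis unfolding gauss_integral_def by (simp only: integral_mult_right_zero)
qed

text \<open>Since the Hermite polynomials are monic, subtracting a multiple of one lowers the degree.\<close>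

lemma hermite_in_closed_span_imp_poly:
  assumes S: "S \<subseteq> L2" and H: "\<And>n. (\<lambda>t. poly (hermite n) (of_real t) * gaussian t) \<in> L2_closed_span S"
  shows "(\<lambda>t. poly P (complex_of_real t) * gaussian t) \<in> L2_closed_span S"
proof (induction "degree P" arbitrary: P rule: less_induct)
  case less
  define n where "n = degree P"
  \<comment> \<open>The remainder is either zero or of smaller degree.\<close>
  define R where "R = P - smult (lead_coeff P) (hermite n)"
  have deg: "degree R \<le> n" unfolding R_def
    by (intro degree_diff_le order_trans[OF degree_smult_le] degree_hermite_le) (simp add: n_def)
  have c0: "coeff R n = 0" by (simp add: R_def n_def coeff_hermite)
  have R: "(\<lambda>t. poly R (complex_of_real t) * gaussian t) \<in> L2_closed_span S"
  proof (cases "R = 0")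
    case True
    then show ?thesis using closed_span_zero[OF S] by (simp add: zero_fun_def)
  next
    case False
    then have "degree R \<noteq> n" using c0 leading_coeff_0_iff by blast
    then show ?thesis using deg by (intro less) (simp add: n_def)
  qed
  have "(\<lambda>t. poly P (complex_of_real t) * gaussian t)
      = (\<lambda>t. poly R (complex_of_real t) * gaussian t) + fun_scale (lead_coeff P) (\<lambda>t. poly (hermite n) (of_real t) * gaussian t)"
    by (auto simp: R_def fun_scale_def fun_eq_iff ring_distribs)
  then show ?case
    using closed_span_add[OF S R closed_span_scale[OF S H]] by simp
qed

text \<open>Only positivity of the constants and \<open>e n * h (n + 1) \<longlonglongrightarrow> 0\<close> matter here: the first makes
\<open>h (N + 1)\<close> a functional that detects \<open>f N\<close> alone, the second puts the Gaussian into the closed span.\<close>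

lemma exact_perturbed_hermite_system:
  fixes c e :: "nat \<Rightarrow> real"
  assumes c: "\<And>n. c n > 0" and e: "\<And>n. e n > 0"
    and small: "\<And>n. (e n)\<^sup>2 * (LINT t|lborel. (cmod (poly (hermite (Suc n)) (of_real t) * gaussian t))\<^sup>2) \<le> (1/2) ^ n"
  shows "exact_system (\<lambda>n. perturbed_gaussian (c n) (e n) (\<lambda>t. poly (hermite (Suc n)) (of_real t)))"
proof -
  define f where "f n = perturbed_gaussian (c n) (e n) (\<lambda>t. poly (hermite (Suc n)) (of_real t))" for n
  define h where "h n t = poly (hermite n) (complex_of_real t) * gaussian t" for n t
  have hL2: "h n \<in> L2" for n unfolding h_def[abs_def] by (intro exp_growth_gaussian_L2 exp_growth_poly)
  have fL2: "f n \<in> L2" for n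
    unfolding f_def perturbed_gaussian_poly by (intro exp_growth_gaussian_L2 exp_growth_poly)
  then have range: "range f \<subseteq> L2" by auto
  have f_eq: "f n t = of_real (c n) * (gaussian t + of_real (e n) * h (Suc n) t)" for n t
    by (simp add: f_def perturbed_gaussian_def h_def ring_distribs mult.assoc)

  have "minimal_system f"
    unfolding minimal_system_def
  proof (intro allI notI)
    fix N assume fN: "f N \<in> L2_closed_span (f ` {n. n \<noteq> N})"
    have pair: "(LINT t|lborel. f n t * h (Suc N) t)
        = of_real (c n * e n) * (of_real (sqrt 2) * gauss_integral (2*pi) 0 (hermite (Suc n) * hermite (Suc N)))" for n
    proof -
      have "(LINT t|lborel. f n t * h (Suc N) t)
          = of_real (sqrt 2) * gauss_integral (2*pi) 0 (smult (of_real (c n)) (1 + smult (of_real (e n)) (hermite (Suc n))) * hermite (Suc N))"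
        unfolding f_def perturbed_gaussian_poly h_def by (rule integral_gaussian_product)
      also have "smult (of_real (c n)) (1 + smult (of_real (e n)) (hermite (Suc n))) * hermite (Suc N)
          = smult (of_real (c n)) (1 * hermite (Suc N) + smult (of_real (e n)) (hermite (Suc n) * hermite (Suc N)))"
        by (simp only: mult_smult_left ring_distribs)
      also have "gauss_integral (2*pi) 0 \<dots> = of_real (c n) * (gauss_integral (2*pi) 0 (1 * hermite (Suc N))
          + of_real (e n) * gauss_integral (2*pi) 0 (hermite (Suc n) * hermite (Suc N)))"
        unfolding gauss_integral_smult by (subst gauss_integral_add) (simp_all only: gauss_integral_smult, simp)
      also have "gauss_integral (2*pi) 0 (1 * hermite (Suc N)) = 0"
        by (subst gauss_integral_hermite) auto
      finally show ?thesis by simp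
    qed
    have ortho: "gauss_integral (2*pi) 0 (hermite (Suc n) * hermite (Suc N)) = 0" if "n < N" for n N
      using that degree_hermite_le[of "Suc n"]
      by (subst gauss_integral_hermite) (auto simp: coeff_eq_0 simp del: hermite.simps)
    have "(LINT t|lborel. f n t * h (Suc N) t) = 0" if "n \<noteq> N" for n
    proof -
      have "gauss_integral (2*pi) 0 (hermite (Suc n) * hermite (Suc N)) = 0"
      proof (cases "n < N")
        case False
        with that have "N < n" by simp
        from ortho[OF this] show ?thesis by (simp only: mult.commute)
      qed (rule ortho)
      then show ?thesis by (simp only: pair) simp
    qed
    then have "(LINT t|lborel. f N t * h (Suc N) t) = 0"
      using fL2 by (intro annihilator_closed_span[OF _ hL2 _ fN]) auto
    moreover have "gauss_integral (2*pi) 0 (hermite (Suc N) * hermite (Suc N)) \<noteq> 0"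
      unfolding gauss_integral_hermite[OF degree_hermite_le] coeff_hermite
      using gauss_integral_one_nonzero by (simp del: fact_Suc)
    ultimately show False
      unfolding pair using c[of N] e[of N] by (simp del: hermite.simps)
  qed

  moreover have "complete_system f"
  proof -
    let ?V = "L2_closed_span (range f)"
    have fV: "f n \<in> ?V" for n using span_subset_closed_span[OF range] cfun.span_base by blast
    have sum: "(\<lambda>t. gaussian t + of_real (e n) * h (Suc n) t) \<in> ?V" for n
    proof -
      have "fun_scale (of_real (1 / c n)) (f n) = (\<lambda>t. gaussian t + of_real (e n) * h (Suc n) t)"
        using c[of n] by (auto simp: fun_scale_def f_eq fun_eq_iff)
      then show ?thesis using closed_span_scale[OF range fV] by metis
    qed
    have gL2: "gaussian \<in> L2" using exp_growth_gaussian_L2[OF exp_growth_const[of 1]] by simp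
    have g: "gaussian \<in> ?V"
    proof (rule closed_span_closed[OF range gL2])
      fix d :: real assume "d > 0"
      then obtain n where n: "(1/2) ^ n < d" using real_arch_pow_inv[of d "1/2"] by auto
      have "energy (gaussian - (\<lambda>t. gaussian t + of_real (e n) * h (Suc n) t)) = energy (fun_scale (of_real (- e n)) (h (Suc n)))"
        by (rule arg_cong[of _ _ energy]) (auto simp: fun_scale_def fun_eq_iff)
      also have "\<dots> = ennreal ((e n)\<^sup>2) * energy (h (Suc n))"
        by (subst energy_scale[OF mem_L2_borel[OF hL2]]) simp
      also have "energy (h (Suc n)) = ennreal (LINT t|lborel. (cmod (poly (hermite (Suc n)) (of_real t) * gaussian t))\<^sup>2)"
        unfolding energy_def h_def by (intro nn_integral_eq_integral integrable_energy_gaussian exp_growth_poly) auto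
      also have "ennreal ((e n)\<^sup>2) * \<dots> = ennreal ((e n)\<^sup>2 * (LINT t|lborel. (cmod (poly (hermite (Suc n)) (of_real t) * gaussian t))\<^sup>2))"
        by (rule ennreal_mult[symmetric]) auto
      also have "\<dots> < ennreal d"
        using small[of n] n \<open>d > 0\<close> by (intro ennreal_lessI) linarith+
      finally show "\<exists>v\<in>?V. energy (gaussian - v) < ennreal d" using sum by blast
    qed
    have hV: "(\<lambda>t. poly (hermite n) (of_real t) * gaussian t) \<in> ?V" for n
    proof (cases n)
      case (Suc m)
      have "fun_scale (of_real (1 / e m)) ((\<lambda>t. gaussian t + of_real (e m) * h (Suc m) t) - gaussian) = h (Suc m)"
        using e[of m] by (auto simp: fun_scale_def fun_eq_iff)
      then have "h (Suc m) \<in> ?V"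
        using closed_span_scale[OF range closed_span_diff[OF range sum g]] by metis
      then show ?thesis by (simp add: h_def[abs_def] Suc del: hermite.simps)
    qed (use g in simp)
    interpret gaussian_polys_in_closed_span "range f"
      by unfold_locales (use range hermite_in_closed_span_imp_poly[OF range hV] in auto)
    show ?thesis unfolding complete_system_def by (rule V_eq_L2)
  qed
  ultimately show ?thesis using fL2 unfolding exact_system_def f_def by blast
qed

theorem theorem5p2:
  fixes p q \<epsilon> :: real
  assumes "p > 1" and "q > 1" and "\<epsilon> > 0"
  shows "\<exists>f :: nat \<Rightarrow> real \<Rightarrow> complex.
    exact_system f \<and>
    (\<forall>n. L2_norm (f n) = 1) \<and>
    (\<forall>n. dispersion p (f n) < \<infinity> \<and> \<bar>p_mean p (f n)\<bar> < \<epsilon> \<and>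
         dispersion q (fourier (f n)) < \<infinity> \<and> \<bar>p_mean q (fourier (f n))\<bar> < \<epsilon> \<and>
         dispersion p (f n) < dispersion p gaussian + ennreal \<epsilon> \<and>
         dispersion q (fourier (f n)) < dispersion q (fourier gaussian) + ennreal \<epsilon>) \<and>
    (\<lambda>t. SUP n. ennreal (cmod (f n t))) \<in> nonneg_L2 \<and>
    (\<lambda>\<xi>. SUP n. ennreal (cmod (fourier (f n) \<xi>))) \<in> nonneg_L2"
proof -
  have "\<exists>Q. \<forall>\<xi>. gauss_integral pi (- 2 * pi * \<xi>) (hermite (Suc n)) = poly Q (of_real \<xi>) * of_real (exp (- pi * \<xi>\<^sup>2))" for n
    by (rule gauss_integral_fourier)
  then obtain Q where Q: "\<And>n \<xi>. gauss_integral pi (- 2 * pi * \<xi>) (hermite (Suc n)) = poly (Q n) (of_real \<xi>) * of_real (exp (- pi * \<xi>\<^sup>2))"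
    by metis
  define \<phi> where "\<phi> n t = poly (hermite (Suc n)) (complex_of_real t)" for n t
  define \<psi> where "\<psi> n t = poly (Q n) (complex_of_real t)" for n t
  have eg: "exp_growth (\<phi> n)" "exp_growth (\<psi> n)" for n
    unfolding \<phi>_def[abs_def] \<psi>_def[abs_def] by (rule exp_growth_poly)+
  define good where "good n e c \<longleftrightarrow> 0 < e \<and> 0 < c \<and> c \<le> 2 \<and> L2_norm (perturbed_gaussian c e (\<phi> n)) = 1
    \<and> localized p \<epsilon> (perturbed_gaussian c e (\<phi> n)) \<and> localized q \<epsilon> (perturbed_gaussian c e (\<psi> n))
    \<and> e\<^sup>2 * (LINT t|lborel. (cmod (\<phi> n t * gaussian t))\<^sup>2) \<le> (1/2) ^ n
    \<and> e\<^sup>2 * (LINT t|lborel. (cmod (\<psi> n t * gaussian t))\<^sup>2) \<le> (1/2) ^ n" for n e c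
  have "\<exists>e c. good n e c" for n
    unfolding good_def \<phi>_def[abs_def] \<psi>_def[abs_def] by (rule exists_small_perturbation[OF assms]) simp
  then obtain e c where good: "\<And>n. good n (e n) (c n)" by metis
  have ec: "0 < e n" "0 < c n" "c n \<le> 2"
    "L2_norm (perturbed_gaussian (c n) (e n) (\<phi> n)) = 1"
    "localized p \<epsilon> (perturbed_gaussian (c n) (e n) (\<phi> n))"
    "localized q \<epsilon> (perturbed_gaussian (c n) (e n) (\<psi> n))"
    "(e n)\<^sup>2 * (LINT t|lborel. (cmod (\<phi> n t * gaussian t))\<^sup>2) \<le> (1/2) ^ n"
    "(e n)\<^sup>2 * (LINT t|lborel. (cmod (\<psi> n t * gaussian t))\<^sup>2) \<le> (1/2) ^ n" for n
    using good[of n] unfolding good_def by blast+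
  define f where "f n = perturbed_gaussian (c n) (e n) (\<phi> n)" for n
  have f_borel: "f n \<in> borel_measurable borel" for n
    unfolding f_def by (intro borel_perturbed_gaussian exp_growth_borel eg)
  have ft: "is_fourier_transform (f n) (perturbed_gaussian (c n) (e n) (\<psi> n))" for n
    unfolding f_def \<phi>_def[abs_def] \<psi>_def[abs_def] by (rule is_fourier_transform_perturbed_gaussian[OF Q])
  have F: "fourier (f n) \<in> L2" "AE \<xi> in lborel. fourier (f n) \<xi> = perturbed_gaussian (c n) (e n) (\<psi> n) \<xi>" for n
    by (rule fourier_AE_eq[OF f_borel ft])+
  have "exact_system f"
    unfolding f_def[abs_def] \<phi>_def[abs_def] 
    using exact_perturbed_hermite_system[of c e] ec unfolding \<phi>_def by blast
  moreover have "L2_norm (f n) = 1" "localized p \<epsilon> (f n)" for n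
    by (simp_all add: f_def ec)
  moreover have "localized q \<epsilon> (fourier (f n))" for n
    using ec(6)[of n] by (simp add: localized_def dispersion_cong_AE[OF F(2)] p_mean_cong_AE[OF F(2)])
  moreover have "dispersion q (fourier gaussian) = dispersion q gaussian"
    by (rule dispersion_cong_AE[OF fourier_gaussian_AE])
  moreover have "(\<lambda>t. SUP n. ennreal (cmod (f n t))) \<in> nonneg_L2"
    by (rule envelope_nonneg_L2[where \<phi> = \<phi> and c = c and e = e, OF eg(1) _ ec(3) ec(7) f_borel])
       (simp_all add: f_def less_imp_le ec)
  moreover have "(\<lambda>\<xi>. SUP n. ennreal (cmod (fourier (f n) \<xi>))) \<in> nonneg_L2"
    by (rule envelope_nonneg_L2[where \<phi> = \<psi> and c = c and e = e, OF eg(2) _ ec(3) ec(8) mem_L2_borel[OF F(1)] F(2)])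
       (simp add: less_imp_le ec)
  ultimately show ?thesis
    by (intro exI[of _ f]) (simp add: localized_def)
qed

end
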